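(* Let $\mathbb T$ be a time scale, $a,b\in\mathbb T$ with $a<b$, $A,B\in\mathbb R$, and let $\bar L:\mathbb T\times\mathbb R\times\mathbb R\to\mathbb R$, $(t,x,r)\mapsto\bar L(t,x,r)$, be of class $C^2$ in the second and third variables and ld-continuous in the first variable. Consider the variational problem $$\bar{\mathcal L}(h)=\int_a^b\bar L\big(t,h^\rho(t),h^\nabla(t)\big)\nabla t,\qquad h(a)=A,\ h(b)=B.$$ Assume that $$\nu(t)\,\bar L(t,x,\gamma r_1+(1-\gamma)r_2)\le\nu(t)\,\gamma\,\bar L(t,x,r_1)+\nu(t)(1-\gamma)\,\bar L(t,x,r_2)$$ for each $(t,x)\in[a,b]_\kappa\times\mathbb R$, all $r_1,r_2\in\mathbb R$ and $\gamma\in[0,1]$. Let $\bar x$ be a piecewise continuous function. If $\bar x$ is a strong local minimum for this problem, then $$E\big(t,\bar x^\rho(t),\bar x^\nabla(t),q\big)\ge0\quad\text{for all }t\in[a,b]_\kappa\text{ and }q\in\mathbb R,$$ where $E(t,x,r,q)=\bar L(t,x,q)-\bar L(t,x,r)-(q-r)\bar L_r(t,x,r)$ is the Weierstrass excess function of $\bar L$, and where $\bar x^\nabla(t)$ is replaced by $\bar x^\nabla(t-)$ and $\bar x^\nabla(t+)$ at the finitely many points $t$ where $\bar x^\nabla(t)$ does not exist.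
   Context: A time scale is a nonempty closed subset $\mathbb T\subseteq\mathbb R$. Jump operators: $\sigma(t)=\inf\{s\in\mathbb T:s>t\}$, $\rho(t)=\sup\{s\in\mathbb T:s<t\}$, with $\inf\emptyset=\sup\mathbb T$, $\sup\emptyset=\inf\mathbb T$. A point $t$ is right-dense if $\sigma(t)=t$ and left-dense if $\rho(t)=t$. Backward graininess: $\nu(t)=t-\rho(t)$. $\mathbb T_\kappa=\mathbb T\setminus[\inf\mathbb T,\sigma(\inf\mathbb T))$ if $\inf\mathbb T>-\infty$, and $\mathbb T_\kappa=\mathbb T$ otherwise. For $a<b$ in $\mathbb T$, $[a,b]$ denotes $\{t\in\mathbb T:a\le t\le b\}$, and $[a,b]_\kappa=[\sigma(a),b]$. For a function $h$, $h^\rho=h\circ\rho$. Nabla derivative: $f$ is nabla differentiable at $t\in\mathbb T_\kappa$ with $f^\nabla(t)=\beta$ if for every $\epsilon>0$ there is a neighborhood $U$ of $t$ such that $|f(\rho(t))-f(s)-\beta(\rho(t)-s)|\le\epsilon|\rho(t)-s|$ for all $s\in U$. $f^\nabla(t-)$ and $f^\nabla(t+)$ denote the left- and right-sided limits of $f^\nabla$ at $t$. A function is ld-continuous if it is continuous at left-dense points and has finite right-sided limits at all right-dense points. $C^1_{ld}$ is the set of functions $f:[a,b]\to\mathbb R$ such that $f^\nabla(t)$ exists for all $t\in[a,b]_\kappa$ and $f^\nabla$ is ld-continuous. Piecewise continuity is understood in the nabla sense: a function is piecewise ld-continuous if it has finite left-sided limits at all left-dense points and finite right-sided limits at all right-dense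 points, and is ld-continuous at all, except possibly finitely many, left-dense points. As the last clause of the claim presupposes, $\bar x^\nabla$ exists except at finitely many points. Nabla integral: $\int_a^bf(t)\nabla t=F(b)-F(a)$, where $F$ is an antiderivative of $f$, i.e. $F^\nabla=f$. $\bar L_r$ is the partial derivative of $\bar L$ with respect to its third variable. Strong local minimum: $\bar x(a)=A$, $\bar x(b)=B$, and there is $\delta>0$ such that $\bar{\mathcal L}(\bar x)\le\bar{\mathcal L}(y)$ for all $y\in C^1_{ld}$ with $y(a)=A$, $y(b)=B$ and $\max_{t\in[a,b]_\kappa}|y^\rho(t)-\bar x^\rho(t)|\le\delta$.
   Formalization: Here x̄ is continuous with piecewise ld-continuous nabla derivative (for x̄ with jumps the claim is false), and ld-continuity of L in t is taken jointly with (x,r), since otherwise the functional can be undefined. *)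

theory Defs
  imports "HOL-Analysis.Analysis"
begin

section \<open>Time scales\<close>

definition time_scale :: "real set \<Rightarrow> bool" where
  "time_scale T \<longleftrightarrow> T \<noteq> {} \<and> closed T"

text \<open>If \<open>T\<close> is unbounded above, then \<open>{s \<in> T. s > t}\<close> is never empty, so the junk value
  \<open>Sup T\<close> is not used; likewise for \<open>ts_rho\<close>.\<close>

definition ts_sigma :: "real set \<Rightarrow> real \<Rightarrow> real" where
  "ts_sigma T t = (if {s \<in> T. s > t} = {} then Sup T else Inf {s \<in> T. s > t})"

definition ts_rho :: "real set \<Rightarrow> real \<Rightarrow> real" where
  "ts_rho T t = (if {s \<in> T. s < t} = {} then Inf T else Sup {s \<in> T. s < t})"

text \<open>With these conventions the minimum of a time scale is left-dense and its maximum is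
  right-dense.\<close>

definition right_dense :: "real set \<Rightarrow> real \<Rightarrow> bool" where
  "right_dense T t \<longleftrightarrow> ts_sigma T t = t"

definition left_dense :: "real set \<Rightarrow> real \<Rightarrow> bool" where
  "left_dense T t \<longleftrightarrow> ts_rho T t = t"

definition ts_nu :: "real set \<Rightarrow> real \<Rightarrow> real" where
  "ts_nu T t = t - ts_rho T t"

definition kappa :: "real set \<Rightarrow> real set" where
  "kappa T = (if bdd_below T then T - {Inf T..<ts_sigma T (Inf T)} else T)"

text \<open>The interval \<open>[a,b]\<close> of \<open>T\<close> is itself a time scale.  Functions that are defined on it
  only (such as the admissible functions below) are treated relative to this time scale, so that
  their values outside \<open>[a,b]\<close> never matter.  The lemma shows that \<open>kappa\<close> then gives
  \<open>[\<sigma>(a),b]\<close>.\<close>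

definition ts_interval :: "real set \<Rightarrow> real \<Rightarrow> real \<Rightarrow> real set" where
  "ts_interval T a b = {t \<in> T. a \<le> t \<and> t \<le> b}"

lemma kappa_ts_interval:
  assumes "a \<in> T" "b \<in> T" "a < b"
  shows "kappa (ts_interval T a b) = {t \<in> T. ts_sigma T a \<le> t \<and> t \<le> b}"
proof -
  let ?I = "ts_interval T a b"
  have Inf_I: "Inf ?I = a"
    using assms by (intro cInf_eq_minimum) (auto simp: ts_interval_def)
  have bdd: "bdd_below ?I"
    by (rule bdd_belowI[of _ a]) (auto simp: ts_interval_def)
  have neT: "b \<in> {s \<in> T. s > a}" and neI: "b \<in> {s \<in> ?I. s > a}"
    using assms by (auto simp: ts_interval_def)
  have bT: "bdd_below {s \<in> T. s > a}" and bI: "bdd_below {s \<in> ?I. s > a}"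
    by (rule bdd_belowI[of _ a]; simp)+
  have le: "Inf {s \<in> T. s > a} \<le> Inf {s \<in> ?I. s > a}"
    using neI bT by (intro cInf_superset_mono) (auto simp: ts_interval_def)
  have ge: "Inf {s \<in> ?I. s > a} \<le> Inf {s \<in> T. s > a}"
  proof (rule cInf_greatest)
    show "{s \<in> T. s > a} \<noteq> {}" using neT by blast
  next
    fix s assume s: "s \<in> {s \<in> T. s > a}"
    show "Inf {s \<in> ?I. s > a} \<le> s"
    proof (cases "s \<le> b")
      case True
      then show ?thesis using s by (intro cInf_lower[OF _ bI]) (auto simp: ts_interval_def)
    next
      case False
      then show ?thesis using cInf_lower[OF neI bI] by linarith
    qed
  qed
  have sig: "ts_sigma ?I a = ts_sigma T a"
  proof -
    have "{s \<in> T. s > a} \<noteq> {}" "{s \<in> ?I. s > a} \<noteq> {}" using neT neI by blast+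
    then have "ts_sigma ?I a = Inf {s \<in> ?I. s > a}" "ts_sigma T a = Inf {s \<in> T. s > a}"
      by (simp_all only: ts_sigma_def if_False)
    then show ?thesis using le ge by linarith
  qed
  have "a \<le> ts_sigma T a"
  proof -
    have "{s \<in> T. s > a} \<noteq> {}" using neT by blast
    moreover from this have "a \<le> Inf {s \<in> T. s > a}" by (intro cInf_greatest) auto
    ultimately show ?thesis by (simp only: ts_sigma_def if_False)
  qed
  then show ?thesis
    using bdd unfolding kappa_def Inf_I sig by (auto simp: ts_interval_def)
qed

section \<open>Nabla derivative\<close>

definition has_nabla_deriv :: "real set \<Rightarrow> (real \<Rightarrow> real) \<Rightarrow> real \<Rightarrow> real \<Rightarrow> bool" where
  "has_nabla_deriv T f t \<beta> \<longleftrightarrow> t \<in> kappa T \<and>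
     (\<forall>\<epsilon>>0. \<exists>U. open U \<and> t \<in> U \<and>
        (\<forall>s\<in>U \<inter> T. \<bar>f (ts_rho T t) - f s - \<beta> * (ts_rho T t - s)\<bar> \<le> \<epsilon> * \<bar>ts_rho T t - s\<bar>))"

definition nabla_differentiable :: "real set \<Rightarrow> (real \<Rightarrow> real) \<Rightarrow> real \<Rightarrow> bool" where
  "nabla_differentiable T f t \<longleftrightarrow> (\<exists>\<beta>. has_nabla_deriv T f t \<beta>)"

definition nabla_deriv :: "real set \<Rightarrow> (real \<Rightarrow> real) \<Rightarrow> real \<Rightarrow> real" where
  "nabla_deriv T f t = (THE \<beta>. has_nabla_deriv T f t \<beta>)"

definition nabla_deriv_left :: "real set \<Rightarrow> (real \<Rightarrow> real) \<Rightarrow> real \<Rightarrow> real" where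
  "nabla_deriv_left T f t = Lim (at t within kappa T \<inter> {..<t}) (nabla_deriv T f)"

definition nabla_deriv_right :: "real set \<Rightarrow> (real \<Rightarrow> real) \<Rightarrow> real \<Rightarrow> real" where
  "nabla_deriv_right T f t = Lim (at t within kappa T \<inter> {t<..}) (nabla_deriv T f)"

section \<open>Ld-continuity\<close>

text \<open>\<open>D\<close> is the domain of \<open>f\<close>; \<open>T\<close> is the ambient time scale, which determines the left- and
  right-dense points.\<close>

definition ld_continuous_at :: "real set \<Rightarrow> real set \<Rightarrow> (real \<Rightarrow> real) \<Rightarrow> real \<Rightarrow> bool" where
  "ld_continuous_at T D f t \<longleftrightarrow>
     (left_dense T t \<longrightarrow> continuous (at t within D) f) \<and>
     (right_dense T t \<longrightarrow> (\<exists>l. (f \<longlongrightarrow> l) (at t within D \<inter> {t<..})))"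

definition ld_continuous_on :: "real set \<Rightarrow> real set \<Rightarrow> (real \<Rightarrow> real) \<Rightarrow> bool" where
  "ld_continuous_on T D f \<longleftrightarrow> (\<forall>t\<in>D. ld_continuous_at T D f t)"

definition piecewise_ld_continuous_on :: "real set \<Rightarrow> real set \<Rightarrow> (real \<Rightarrow> real) \<Rightarrow> bool" where
  "piecewise_ld_continuous_on T D f \<longleftrightarrow>
     (\<forall>t\<in>D. left_dense T t \<longrightarrow> (\<exists>l. (f \<longlongrightarrow> l) (at t within D \<inter> {..<t}))) \<and>
     (\<forall>t\<in>D. right_dense T t \<longrightarrow> (\<exists>l. (f \<longlongrightarrow> l) (at t within D \<inter> {t<..}))) \<and>
     (\<exists>S. finite S \<and> (\<forall>t\<in>S. left_dense T t) \<and> (\<forall>t\<in>D - S. ld_continuous_at T D f t))"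

definition C1_ld :: "real set \<Rightarrow> (real \<Rightarrow> real) \<Rightarrow> bool" where
  "C1_ld T f \<longleftrightarrow>
     (\<forall>t\<in>kappa T. nabla_differentiable T f t) \<and> ld_continuous_on T (kappa T) (nabla_deriv T f)"

text \<open>The piecewise version of \<open>C1_ld\<close>: jumps are allowed in the derivative, not in the function.
  The value of \<open>nabla_deriv T f\<close> at the finitely many points where \<open>f\<close> is not nabla
  differentiable is irrelevant: since \<open>f\<close> is continuous, these points are left-dense, so they can
  be put into the exceptional set of \<open>piecewise_ld_continuous_on\<close>.\<close>

definition C1_pld :: "real set \<Rightarrow> (real \<Rightarrow> real) \<Rightarrow> bool" where
  "C1_pld T f \<longleftrightarrow> continuous_on T f \<and>
     finite {t \<in> kappa T. \<not> nabla_differentiable T f t} \<and>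
     piecewise_ld_continuous_on T (kappa T) (nabla_deriv T f)"

section \<open>Nabla integral\<close>

text \<open>Integrands coming from a piecewise smooth function are undefined at its corners and jump
  there, so they have no antiderivative in the strict sense.  As usual, an antiderivative is
  therefore a continuous function that satisfies \<open>F\<^sup>\<nabla> = f\<close> except at finitely many left-dense
  points (at a left-scattered point an exception would destroy uniqueness of the integral).\<close>

definition nabla_antiderivative :: "real set \<Rightarrow> (real \<Rightarrow> real) \<Rightarrow> (real \<Rightarrow> real) \<Rightarrow> bool" where
  "nabla_antiderivative T F f \<longleftrightarrow> continuous_on T F \<and>
     (\<exists>S. finite S \<and> (\<forall>t\<in>S. left_dense T t) \<and> (\<forall>t\<in>kappa T - S. has_nabla_deriv T F t (f t)))"

definition nabla_integral :: "real set \<Rightarrow> real \<Rightarrow> real \<Rightarrow> (real \<Rightarrow> real) \<Rightarrow> real" where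
  "nabla_integral T a b f =
     (THE J. \<exists>F. nabla_antiderivative (ts_interval T a b) F f \<and> J = F b - F a)"

section \<open>Lagrangians and the variational problem\<close>

definition C2_fun :: "(real \<times> real \<Rightarrow> real) \<Rightarrow> bool" where
  "C2_fun g \<longleftrightarrow> (\<exists>(D :: real \<times> real \<Rightarrow> (real \<times> real) \<Rightarrow>\<^sub>L real)
       (D2 :: real \<times> real \<Rightarrow> (real \<times> real) \<Rightarrow>\<^sub>L ((real \<times> real) \<Rightarrow>\<^sub>L real)).
       (\<forall>z. (g has_derivative blinfun_apply (D z)) (at z)) \<and>
       (\<forall>z. (D has_derivative blinfun_apply (D2 z)) (at z)) \<and>
       continuous_on UNIV D2)"

text \<open>Ld-continuity of \<open>L\<close> in \<open>t\<close> is locally uniform in \<open>(x,r)\<close>, i.e. the limits at dense points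
  are joint limits in \<open>(t,x,r)\<close>.  If they were only required separately for each fixed \<open>(x,r)\<close>,
  the integrand \<open>L(t, h\<^sup>\<rho>(t), h\<^sup>\<nabla>(t))\<close> of an admissible \<open>h\<close> could be unbounded and the functional
  undefined.\<close>

definition ld_continuous_first :: "real set \<Rightarrow> (real \<Rightarrow> real \<Rightarrow> real \<Rightarrow> real) \<Rightarrow> bool" where
  "ld_continuous_first T L \<longleftrightarrow> (\<forall>t\<in>T. \<forall>x r.
     (left_dense T t \<longrightarrow>
        continuous (at (t, x, r) within T \<times> UNIV) (\<lambda>(s, y, p). L s y p)) \<and>
     (right_dense T t \<longrightarrow>
        (\<exists>l. ((\<lambda>(s, y, p). L s y p) \<longlongrightarrow> l) (at (t, x, r) within (T \<inter> {t<..}) \<times> UNIV))))"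

definition functional ::
  "(real \<Rightarrow> real \<Rightarrow> real \<Rightarrow> real) \<Rightarrow> real set \<Rightarrow> real \<Rightarrow> real \<Rightarrow> (real \<Rightarrow> real) \<Rightarrow> real" where
  "functional L T a b h =
     nabla_integral T a b
       (\<lambda>t. L t (h (ts_rho (ts_interval T a b) t)) (nabla_deriv (ts_interval T a b) h t))"

definition strong_local_min ::
  "(real \<Rightarrow> real \<Rightarrow> real \<Rightarrow> real) \<Rightarrow> real set \<Rightarrow> real \<Rightarrow> real \<Rightarrow> real \<Rightarrow> real \<Rightarrow> (real \<Rightarrow> real) \<Rightarrow> bool"
where
  "strong_local_min L T a b A B xb \<longleftrightarrow> xb a = A \<and> xb b = B \<and>
     (\<exists>\<delta>>0. \<forall>y. C1_ld (ts_interval T a b) y \<and> y a = A \<and> y b = B \<and>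
        (\<forall>t\<in>kappa (ts_interval T a b).
           \<bar>y (ts_rho (ts_interval T a b) t) - xb (ts_rho (ts_interval T a b) t)\<bar> \<le> \<delta>)
        \<longrightarrow> functional L T a b xb \<le> functional L T a b y)"

definition excess :: "(real \<Rightarrow> real \<Rightarrow> real \<Rightarrow> real) \<Rightarrow> real \<Rightarrow> real \<Rightarrow> real \<Rightarrow> real \<Rightarrow> real" where
  "excess L t x r q = L t x q - L t x r - (q - r) * deriv (L t x) r"

end

theory Submission
  imports Defs
begin

text \<open>Wherever \<open>\<nu> > 0\<close>, the Lagrangian is convex in its third variable, and the excess inequality
  says that a convex function lies above its tangents. At a left-dense point \<open>t\<close>, either
  left-scattered points accumulate, and convexity passes to the limit by joint continuity, or the
  time scale contains an interval adjacent to \<open>t\<close>. On such an interval the derivative of the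
  minimizer is perturbed by the slopes \<open>m = q - r\<close> and \<open>-\<kappa> m\<close> on consecutive pieces with
  lengths in the ratio \<open>\<kappa> : 1\<close>. Shrinking the interval gives
  \<open>\<kappa> L(r + m) + L(r - \<kappa> m) \<ge> (1 + \<kappa>) L(r)\<close>, and \<open>\<kappa> \<rightarrow> 0\<close> yields the excess inequality. Only the
  joint continuity of \<open>L\<close> itself enters, since its partial derivatives need not be continuous in
  \<open>t\<close>. Nabla integrals are computed as integrals over the real interval \<open>[a,b]\<close> after extending the
  integrand to be constant on each gap \<open>(\<rho>(t), t]\<close>.\<close>

section \<open>Compact time scales inside the real line\<close>

text \<open>With slopes \<open>m\<close> and \<open>-\<kappa> m\<close> on lengths in the ratio
  \<open>\<kappa> : 1\<close> the increments cancel, so nothing changes outside one short interval.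
  Division by \<open>\<kappa>\<close> turns the inequality into \<open>L(r + m) - L(r) + (L(r -
  \<kappa> m) - L(r)) / \<kappa> \<ge> 0\<close>, whose last term is a difference quotient in the
  third variable alone; hence \<open>L_r\<close> is only taken with \<open>(t, x)\<close> frozen.
  Two obstacles shape the rest. The minimum property admits only competitors with ld-continuous
  nabla derivative, whereas the perturbed minimizer has corners, its own and those of the variation.
  It is reached as a limit of admissible functions, and the functional must be shown to converge
  along them. Moreover, density is relative: \<open>a\<close> is left-dense in \<open>[a,b]\<close>
  by convention but may be left-scattered in \<open>T\<close>, while the ld-continuity of
  \<open>L\<close> and the weight \<open>\<nu>\<close> in the convexity assumption refer to
  \<open>T\<close>. Points with positive \<open>\<nu>\<close> in \<open>T\<close> are settled by
  convexity, which leaves only points that are left-dense in both time scales.\<close>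

lemma left_right_limits_imp_uniform_step:
  fixes h :: "real \<Rightarrow> real"
  assumes "a \<le> b"
    and L: "\<And>x. a < x \<Longrightarrow> x \<le> b \<Longrightarrow> \<exists>l. (h \<longlongrightarrow> l) (at_left x)"
    and R: "\<And>x. a \<le> x \<Longrightarrow> x < b \<Longrightarrow> \<exists>l. (h \<longlongrightarrow> l) (at_right x)"
    and "e > 0"
  shows "\<exists>g. g integrable_on {a..b} \<and> bounded (g ` {a..b}) \<and> (\<forall>x\<in>{a..b}. \<bar>h x - g x\<bar> \<le> e)"
proof -
  \<comment> \<open>Bisection: \<open>P\<close> passes to the union of adjacent intervals and holds
    on short intervals around each point. The guards are there because \<open>Bolzano\<close> also
    produces short intervals that stick out of \<open>[a,b]\<close>.\<close>
  define P where "P u v \<longleftrightarrow> a \<le> u \<longrightarrow> v \<le> b \<longrightarrow> u \<le> v \<longrightarrow>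
    (\<exists>g. g integrable_on {u..v} \<and> bounded (g ` {u..v}) \<and> (\<forall>x\<in>{u..v}. \<bar>h x - g x\<bar> \<le> e))" for u v
  have "P a b"
    using \<open>a \<le> b\<close>
  proof (induction rule: Bolzano)
    case (trans u w v)
    show ?case
      unfolding P_def
    proof (intro impI)
      assume uv: "a \<le> u" "v \<le> b" "u \<le> v"
      obtain g1 where g1: "g1 integrable_on {u..w}" "bounded (g1 ` {u..w})"
          "\<And>x. x \<in> {u..w} \<Longrightarrow> \<bar>h x - g1 x\<bar> \<le> e"
        using trans uv unfolding P_def by force
      obtain g2 where g2: "g2 integrable_on {w..v}" "bounded (g2 ` {w..v})"
          "\<And>x. x \<in> {w..v} \<Longrightarrow> \<bar>h x - g2 x\<bar> \<le> e"
        using trans uv unfolding P_def by force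
      define g where "g x = (if x \<le> w then g1 x else g2 x)" for x
      have "g integrable_on {u..w}"
        by (rule integrable_spike_finite[OF _ _ g1(1), of "{}"]) (auto simp: g_def)
      moreover have "g integrable_on {w..v}"
        by (rule integrable_spike_finite[OF _ _ g2(1), of "{w}"]) (auto simp: g_def)
      ultimately have "g integrable_on {u..v}"
        using trans by (meson Henstock_Kurzweil_Integration.integrable_combine)
      moreover have "bounded (g ` {u..v})"
        by (rule bounded_subset[of "g1 ` {u..w} \<union> g2 ` {w..v}"]) (use g1 g2 in \<open>auto simp: g_def\<close>)
      moreover have "\<bar>h x - g x\<bar> \<le> e" if "x \<in> {u..v}" for x
        using that g1(3)[of x] g2(3)[of x] by (auto simp: g_def)
      ultimately show "\<exists>g. g integrable_on {u..v} \<and> bounded (g ` {u..v}) \<and> (\<forall>x\<in>{u..v}. \<bar>h x - g x\<bar> \<le> e)"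
        by blast
    qed
  next
    case (local x)
    have "\<exists>l. \<exists>d>0. \<forall>s\<in>{a..b}. x - d < s \<longrightarrow> s < x \<longrightarrow> \<bar>h s - l\<bar> \<le> e"
    proof (cases "a < x")
      case True
      then obtain l where l: "(h \<longlongrightarrow> l) (at_left x)" using L local by blast
      from tendstoD[OF l \<open>e > 0\<close>] obtain c where c: "c < x" "\<And>y. c < y \<Longrightarrow> y < x \<Longrightarrow> dist (h y) l < e"
        by (auto simp: eventually_at_left_field)
      have "0 < x - c" "\<forall>s\<in>{a..b}. x - (x - c) < s \<longrightarrow> s < x \<longrightarrow> \<bar>h s - l\<bar> \<le> e"
        using c(1) c(2) unfolding dist_real_def by (simp, force)
      then show ?thesis by blast
    qed (use local in \<open>auto intro!: exI[of _ 1]\<close>)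
    then obtain l1 d1 where d1: "d1 > 0" "\<And>s. s \<in> {a..b} \<Longrightarrow> x - d1 < s \<Longrightarrow> s < x \<Longrightarrow> \<bar>h s - l1\<bar> \<le> e"
      by blast
    have "\<exists>l. \<exists>d>0. \<forall>s\<in>{a..b}. x < s \<longrightarrow> s < x + d \<longrightarrow> \<bar>h s - l\<bar> \<le> e"
    proof (cases "x < b")
      case True
      then obtain l where l: "(h \<longlongrightarrow> l) (at_right x)" using R local by blast
      from tendstoD[OF l \<open>e > 0\<close>] obtain c where c: "x < c" "\<And>y. x < y \<Longrightarrow> y < c \<Longrightarrow> dist (h y) l < e"
        by (auto simp: eventually_at_right_field)
      have "0 < c - x" "\<forall>s\<in>{a..b}. x < s \<longrightarrow> s < x + (c - x) \<longrightarrow> \<bar>h s - l\<bar> \<le> e"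
        using c(1) c(2) unfolding dist_real_def by (simp, force)
      then show ?thesis by blast
    qed (use local in \<open>auto intro!: exI[of _ 1]\<close>)
    then obtain l2 d2 where d2: "d2 > 0" "\<And>s. s \<in> {a..b} \<Longrightarrow> x < s \<Longrightarrow> s < x + d2 \<Longrightarrow> \<bar>h s - l2\<bar> \<le> e"
      by blast
    \<comment> \<open>Left limit, actual value, right limit: keeping \<open>h x\<close> at
      \<open>x\<close> avoids any condition on \<open>h\<close> at the point itself.\<close>
    define g where "g s = (if s < x then l1 else if s = x then h x else l2)" for s
    have gi: "g integrable_on {u..v}" if "u \<le> x" "x \<le> v" for u v
    proof -
      have "g integrable_on {u..x}"
        by (rule integrable_spike_finite[of "{x}" _ _ "\<lambda>_. l1"]) (auto simp: g_def)
      moreover have "g integrable_on {x..v}"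
        by (rule integrable_spike_finite[of "{x}" _ _ "\<lambda>_. l2"]) (auto simp: g_def)
      ultimately show ?thesis
        using that by (meson Henstock_Kurzweil_Integration.integrable_combine)
    qed
    have gb: "bounded (g ` {u..v})" for u v
      by (rule bounded_subset[of "{l1, h x, l2}"]) (auto simp: g_def)
    have ge: "\<bar>h s - g s\<bar> \<le> e" if "s \<in> {u..v}" "a \<le> u" "v \<le> b" "u \<le> x" "x \<le> v" "v - u < min d1 d2" for s u v
      using that d1(2)[of s] d2(2)[of s] \<open>e > 0\<close> unfolding g_def by fastforce
    show ?case
    proof (intro exI[of _ "min d1 d2"] conjI allI impI)
      fix u v assume uv: "u \<le> x \<and> x \<le> v \<and> v - u < min d1 d2"
      show "P u v"
        unfolding P_def
      proof (intro impI exI[of _ g] conjI ballI)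
        show "g integrable_on {u..v}" using gi uv by blast
        show "bounded (g ` {u..v})" by (rule gb)
        show "\<bar>h s - g s\<bar> \<le> e" if "a \<le> u" "v \<le> b" "u \<le> v" "s \<in> {u..v}" for s
          using ge that uv by blast
      qed
    qed (use d1 d2 in auto)
  qed
  then show ?thesis unfolding P_def using \<open>a \<le> b\<close> by blast
qed

lemma left_right_limits_imp_integrable:
  fixes h :: "real \<Rightarrow> real"
  assumes "a \<le> b"
    and "\<And>x. a < x \<Longrightarrow> x \<le> b \<Longrightarrow> \<exists>l. (h \<longlongrightarrow> l) (at_left x)"
    and "\<And>x. a \<le> x \<Longrightarrow> x < b \<Longrightarrow> \<exists>l. (h \<longlongrightarrow> l) (at_right x)"
  shows "h integrable_on {a..b}"
proof -
  have "h integrable_on cbox a b"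
  proof (rule integrable_uniform_limit)
    fix e :: real assume "e > 0"
    from left_right_limits_imp_uniform_step[OF assms this]
    show "\<exists>g. (\<forall>x\<in>cbox a b. norm (h x - g x) \<le> e) \<and> g integrable_on cbox a b"
      by auto
  qed
  then show ?thesis by simp
qed

lemma left_right_limits_imp_bounded:
  fixes h :: "real \<Rightarrow> real"
  assumes "a \<le> b"
    and "\<And>x. a < x \<Longrightarrow> x \<le> b \<Longrightarrow> \<exists>l. (h \<longlongrightarrow> l) (at_left x)"
    and "\<And>x. a \<le> x \<Longrightarrow> x < b \<Longrightarrow> \<exists>l. (h \<longlongrightarrow> l) (at_right x)"
  shows "\<exists>M. \<forall>x\<in>{a..b}. \<bar>h x\<bar> \<le> M"
proof -
  from left_right_limits_imp_uniform_step[OF assms zero_less_one]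
  obtain g where g: "bounded (g ` {a..b})" "\<And>x. x \<in> {a..b} \<Longrightarrow> \<bar>h x - g x\<bar> \<le> 1" by blast
  from g(1) obtain M where M: "\<And>x. x \<in> {a..b} \<Longrightarrow> \<bar>g x\<bar> \<le> M"
    unfolding bounded_iff by (metis imageI real_norm_def)
  have "\<bar>h x\<bar> \<le> M + 1" if "x \<in> {a..b}" for x
    using M[OF that] g(2)[OF that] by linarith
  then show ?thesis by blast
qed

text \<open>Composition with this map is the gap-constant extension. Rounding up rather than down
  matters because the nabla derivative at \<open>t\<close> governs the gap to the left of
  \<open>t\<close>.\<close>

definition ts_ceil :: "real set \<Rightarrow> real \<Rightarrow> real" where
  "ts_ceil T s = Inf {u \<in> T. s \<le> u}"

section \<open>Jumps and density in a compact time scale\<close>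

locale compact_time_scale =
  fixes I :: "real set" and a b :: real
  assumes closed_I: "closed I" and a_in: "a \<in> I" and b_in: "b \<in> I" and a_less_b: "a < b"
    and I_subset: "I \<subseteq> {a..b}"
begin

abbreviation "rh \<equiv> ts_rho I"
abbreviation "up \<equiv> ts_ceil I"

lemma ge_a: "t \<in> I \<Longrightarrow> a \<le> t" and le_b: "t \<in> I \<Longrightarrow> t \<le> b"
  using I_subset by auto

lemma bdd_I: "bdd_above {s \<in> I. P s}" "bdd_below {s \<in> I. P s}"
  using ge_a le_b by (auto intro: bdd_aboveI[of _ b] bdd_belowI[of _ a])

lemma Inf_I: "Inf I = a" and Sup_I: "Sup I = b"
  using a_in b_in ge_a le_b by (auto intro: cInf_eq_minimum cSup_eq_maximum)

lemma Sup_mem: "A \<subseteq> I \<Longrightarrow> A \<noteq> {} \<Longrightarrow> Sup A \<in> I"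
  using closed_I I_subset
  by (meson bdd_above_Icc bdd_above_mono closed_subset_contains_Sup order_trans)

lemma Inf_mem: "A \<subseteq> I \<Longrightarrow> A \<noteq> {} \<Longrightarrow> Inf A \<in> I"
  using closed_I I_subset
  by (meson bdd_below_Icc bdd_below_mono closed_subset_contains_Inf order_trans)

lemma rho_a: "rh a = a"
proof -
  have "{s \<in> I. s < a} = {}" using ge_a by force
  then show ?thesis by (simp only: ts_rho_def Inf_I refl if_True)
qed

lemma rho_eq: "t \<in> I \<Longrightarrow> a < t \<Longrightarrow> rh t = Sup {s \<in> I. s < t}"
  using a_in by (auto simp: ts_rho_def)

lemma rho_mem: "t \<in> I \<Longrightarrow> rh t \<in> I"
proof (cases "a < t")
  case True
  assume "t \<in> I"
  with True a_in show ?thesis by (subst rho_eq) (auto intro!: Sup_mem)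
next
  case False
  assume "t \<in> I"
  with False ge_a have "t = a" by force
  then show ?thesis using rho_a a_in by simp
qed

lemma rho_le: "t \<in> I \<Longrightarrow> rh t \<le> t"
proof (cases "a < t")
  case True
  assume "t \<in> I"
  with True a_in show ?thesis by (subst rho_eq) (auto intro!: cSup_least)
next
  case False
  assume "t \<in> I"
  with False ge_a have "t = a" by force
  then show ?thesis using rho_a by simp
qed

lemma le_rho: "s \<in> I \<Longrightarrow> t \<in> I \<Longrightarrow> s < t \<Longrightarrow> s \<le> rh t"
  using ge_a[of s] by (subst rho_eq) (auto intro!: cSup_upper bdd_I)

text \<open>The minimum \<open>a\<close> is left-dense by convention although nothing of
  \<open>I\<close> lies below it, hence \<open>a < t\<close>.\<close>

lemma left_denseD:
  assumes "t \<in> I" "a < t" "left_dense I t" "c < t"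
  shows "\<exists>s\<in>I. c < s \<and> s < t"
proof (rule ccontr)
  assume *: "\<not> ?thesis"
  have "rh t \<le> c"
    using assms(1,2) a_in * by (subst rho_eq) (auto intro!: cSup_least simp: not_less)
  with assms show False by (simp add: left_dense_def)
qed

lemma sigma_eq: "t \<in> I \<Longrightarrow> t < b \<Longrightarrow> ts_sigma I t = Inf {s \<in> I. t < s}"
  using b_in by (auto simp: ts_sigma_def)

lemma right_denseD:
  assumes "t \<in> I" "t < b" "right_dense I t" "t < c"
  shows "\<exists>s\<in>I. t < s \<and> s < c"
proof (rule ccontr)
  assume *: "\<not> ?thesis"
  have "c \<le> ts_sigma I t"
    using assms(1,2) b_in * by (subst sigma_eq) (auto intro!: cInf_greatest simp: not_less)
  with assms show False by (simp add: right_dense_def)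
qed

lemma right_dense_b: "right_dense I b"
proof -
  have "{s \<in> I. s > b} = {}" using le_b by force
  then show ?thesis by (simp only: right_dense_def ts_sigma_def Sup_I refl if_True)
qed

lemma left_dense_a: "left_dense I a"
  by (simp add: left_dense_def rho_a)

lemma not_right_denseD:
  assumes "t \<in> I" "\<not> right_dense I t"
  shows "t < b" "\<exists>c>t. c \<in> I \<and> (\<forall>s\<in>I. t < s \<longrightarrow> c \<le> s)"
proof -
  show tb: "t < b" using assms right_dense_b le_b by (metis order_le_less)
  have ne: "{s \<in> I. t < s} \<noteq> {}" using b_in tb by blast
  have "t \<le> ts_sigma I t" using ne by (subst sigma_eq[OF assms(1) tb]) (auto intro!: cInf_greatest)
  with assms have "t < ts_sigma I t" by (simp add: right_dense_def)
  moreover have "ts_sigma I t \<in> I" using ne by (subst sigma_eq[OF assms(1) tb]) (auto intro!: Inf_mem)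
  moreover have "\<forall>s\<in>I. t < s \<longrightarrow> ts_sigma I t \<le> s"
    by (subst sigma_eq[OF assms(1) tb]) (auto intro!: cInf_lower bdd_I)
  ultimately show "\<exists>c>t. c \<in> I \<and> (\<forall>s\<in>I. t < s \<longrightarrow> c \<le> s)" by blast
qed

lemma not_left_denseD:
  assumes "t \<in> I" "\<not> left_dense I t"
  shows "a < t" "rh t < t"
  using assms rho_le[of t] left_dense_a ge_a[of t] by (auto simp: left_dense_def order_le_less)

lemma kappa_subset: "kappa I \<subseteq> I"
  by (auto simp: kappa_def)

lemma kappa_I: "t \<in> I \<Longrightarrow> a < t \<Longrightarrow> t \<in> kappa I"
  using sigma_eq[OF a_in a_less_b]
  by (auto simp: kappa_def Inf_I not_less intro!: cInf_lower bdd_I)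

text \<open>The removed set \<open>[a, \<sigma>(a))\<close> is empty if \<open>a\<close> is
  right-dense and contains \<open>a\<close> otherwise.\<close>

lemma a_kappa_iff: "a \<in> kappa I \<longleftrightarrow> right_dense I a"
proof -
  have "a \<le> ts_sigma I a"
    using a_less_b b_in by (subst sigma_eq[OF a_in a_less_b]) (auto intro!: cInf_greatest)
  moreover have "bdd_below I" using I_subset by (meson bdd_below_Icc bdd_below_mono)
  ultimately show ?thesis using a_in by (auto simp: kappa_def Inf_I right_dense_def)
qed

lemma kappa_cases: "t \<in> kappa I \<Longrightarrow> (t = a \<and> right_dense I a) \<or> (t \<in> I \<and> a < t)"
  using a_kappa_iff kappa_subset ge_a by (metis order_le_less subsetD)

section \<open>The ceiling map and its one-sided behaviour\<close>

lemma ceil_mem: "s \<le> b \<Longrightarrow> up s \<in> I"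
  unfolding ts_ceil_def using b_in by (intro Inf_mem) auto

lemma ceil_ge: "s \<le> b \<Longrightarrow> s \<le> up s"
  unfolding ts_ceil_def using b_in by (intro cInf_greatest) auto

lemma ceil_le: "u \<in> I \<Longrightarrow> s \<le> u \<Longrightarrow> up s \<le> u"
  unfolding ts_ceil_def by (intro cInf_lower bdd_I) auto

lemma ceil_id: "s \<in> I \<Longrightarrow> up s = s"
  using ceil_le[of s s] ceil_ge[of s] le_b by force

lemma ceil_kappa: "a < s \<Longrightarrow> s \<le> b \<Longrightarrow> up s \<in> kappa I"
  using ceil_mem[of s] ceil_ge[of s] by (intro kappa_I) auto

lemma ceil_gap: "t \<in> I \<Longrightarrow> rh t < s \<Longrightarrow> s \<le> t \<Longrightarrow> up s = t"
  using ceil_le[of t s] ceil_ge[of s] ceil_mem[of s] le_rho[of "up s" t] le_b[of t]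
  by force

text \<open>If \<open>s < up s\<close>, left density would give a point of \<open>I\<close> in
  between, against minimality of \<open>up s\<close>. Consequently a left-dense exceptional point
  corresponds to a single real parameter above \<open>a\<close>, and finite exceptional sets stay
  finite on the real line.\<close>

lemma ceil_left_dense: "s \<le> b \<Longrightarrow> left_dense I (up s) \<Longrightarrow> a < s \<Longrightarrow> up s = s"
  using left_denseD[of "up s" s] ceil_mem[of s] ceil_ge[of s] ceil_le[of _ s]
  by force

text \<open>For \<open>s < t\<close> a point of \<open>I\<close> lies between \<open>s\<close> and
  \<open>t\<close>, so rounding up stays strictly below \<open>t\<close>. Limits along
  \<open>kappa I\<close> thereby become limits along the real line.\<close>

lemma filterlim_ceil_left:
  assumes "t \<in> I" "a < t" "left_dense I t"
  shows "filterlim up (at t within kappa I \<inter> {..<t}) (at_left t)"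
  unfolding filterlim_at
proof
  have ev: "\<forall>\<^sub>F s in at_left t. c < s \<and> s < t \<and> a < s" if "c < t" for c
    using assms that by (auto simp: eventually_at_left_field intro!: exI[of _ "max a c"])
  show "\<forall>\<^sub>F s in at_left t. up s \<in> kappa I \<inter> {..<t} \<and> up s \<noteq> t"
    using ev[OF \<open>a < t\<close>]
  proof eventually_elim
    case (elim s)
    obtain u where "u \<in> I" "s < u" "u < t" using left_denseD[OF assms, of s] elim by auto
    with ceil_le[of u s] ceil_kappa[of s] elim le_b[OF \<open>t \<in> I\<close>] show ?case by auto
  qed
  show "(up \<longlongrightarrow> t) (at_left t)"
  proof (rule tendsto_sandwich[of "\<lambda>s. s" _ _ "\<lambda>s. t"])
    show "\<forall>\<^sub>F s in at_left t. s \<le> up s" "\<forall>\<^sub>F s in at_left t. up s \<le> t"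
      using ev[OF \<open>a < t\<close>] ceil_ge ceil_le[OF \<open>t \<in> I\<close>] le_b[OF \<open>t \<in> I\<close>]
      by (auto elim!: eventually_mono)
  qed auto
qed

text \<open>Here \<open>up s > t\<close> is automatic; right density serves to bound
  \<open>up s\<close> from above.\<close>

lemma filterlim_ceil_right:
  assumes "t \<in> I" "t < b" "right_dense I t"
  shows "filterlim up (at t within kappa I \<inter> {t<..}) (at_right t)"
  unfolding filterlim_at
proof
  have ev: "\<forall>\<^sub>F s in at_right t. t < s \<and> s < c" if "t < c" for c
    using that by (auto simp: eventually_at_right_field)
  show "\<forall>\<^sub>F s in at_right t. up s \<in> kappa I \<inter> {t<..} \<and> up s \<noteq> t"
    using ev[OF \<open>t < b\<close>]
  proof eventually_elim
    case (elim s)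
    with ceil_ge[of s] ceil_kappa[of s] ge_a[OF \<open>t \<in> I\<close>] show ?case by auto
  qed
  show "(up \<longlongrightarrow> t) (at_right t)"
  proof (rule order_tendstoI)
    fix c assume "c < t"
    show "\<forall>\<^sub>F s in at_right t. c < up s"
      using ev[OF \<open>t < b\<close>]
    proof eventually_elim
      case (elim s)
      then show ?case using ceil_ge[of s] \<open>c < t\<close> by auto
    qed
  next
    fix c assume "t < c"
    then obtain u where u: "u \<in> I" "t < u" "u < c" using right_denseD[OF assms] by blast
    show "\<forall>\<^sub>F s in at_right t. up s < c"
      using ev[OF u(2)]
    proof eventually_elim
      case (elim s)
      then show ?case using ceil_le[OF u(1), of s] u by auto
    qed
  qed
qed

text \<open>Such an \<open>x\<close> has a whole left neighbourhood inside one gap. For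
  \<open>x\<close> outside \<open>I\<close> the gap begins at \<open>rh (up x) < x\<close>, because
  otherwise \<open>up x\<close> would be left-dense and therefore equal to \<open>x\<close>.\<close>

lemma ceil_eventually_const_left:
  assumes "a < x" "x \<le> b" "\<not> (x \<in> I \<and> left_dense I x)"
  shows "\<forall>\<^sub>F s in at_left x. up s = up x"
proof -
  have "\<exists>c<x. \<forall>s. c < s \<longrightarrow> s < x \<longrightarrow> up s = up x"
  proof (cases "x \<in> I")
    case True
    with assms have "\<not> left_dense I x" by blast
    from not_left_denseD[OF True this] show ?thesis
      using ceil_gap[OF True] ceil_id[OF True] by (metis less_imp_le)
  next
    case False
    have x: "up x \<in> I" "x < up x" using ceil_mem[of x] ceil_ge[of x] assms False
      by (auto simp: order_le_less)
    have "rh (up x) < x"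
    proof (rule ccontr)
      assume "\<not> ?thesis"
      moreover have "rh (up x) \<in> I" using rho_mem x by blast
      ultimately have "x < rh (up x)" using False by (metis linorder_neqE_linordered_idom)
      with ceil_le[of "rh (up x)" x] rho_le[OF x(1)] \<open>rh (up x) \<in> I\<close>
      have "rh (up x) = up x" by auto
      then have "left_dense I (up x)" by (simp add: left_dense_def)
      with ceil_left_dense assms x show False by force
    qed
    then show ?thesis using ceil_gap[OF x(1)] x by (meson less_imp_le less_trans)
  qed
  then show ?thesis by (auto simp: eventually_at_left_field)
qed

lemma ceil_eventually_const_right:
  assumes "a \<le> x" "x < b" "\<not> (x \<in> I \<and> right_dense I x)"
  shows "\<exists>t\<in>I. \<forall>\<^sub>F s in at_right x. up s = t"
proof (cases "x \<in> I")
  case True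
  with assms have "\<not> right_dense I x" by blast
  from not_right_denseD[OF True this] obtain c where
    c: "c \<in> I" "x < c" "\<And>s. s \<in> I \<Longrightarrow> x < s \<Longrightarrow> c \<le> s" by blast
  have "up s = c" if "x < s" "s < c" for s
  proof (rule antisym)
    show "up s \<le> c" using that ceil_le[OF c(1)] by simp
    show "c \<le> up s" using c(3)[of "up s"] ceil_mem[of s] ceil_ge[of s] that le_b[OF c(1)] by simp
  qed
  with c show ?thesis by (auto simp: eventually_at_right_field intro!: bexI[of _ c])
next
  case False
  have x: "up x \<in> I" "x < up x" using ceil_mem[of x] ceil_ge[of x] assms False
    by (auto simp: order_le_less)
  have "up s = up x" if "x < s" "s < up x" for s
  proof (rule antisym)
    show "up s \<le> up x" using that ceil_le[OF x(1)] by simp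
    show "up x \<le> up s" using ceil_le[of "up s" x] ceil_mem[of s] ceil_ge[of s] that le_b[OF x(1)] by simp
  qed
  with x show ?thesis by (auto simp: eventually_at_right_field intro!: bexI[of _ "up x"])
qed

section \<open>Integrability of piecewise ld-continuous functions\<close>

abbreviation "pld \<equiv> piecewise_ld_continuous_on I (kappa I)"

lemma pldD_left: "pld f \<Longrightarrow> t \<in> kappa I \<Longrightarrow> left_dense I t \<Longrightarrow> \<exists>l. (f \<longlongrightarrow> l) (at t within kappa I \<inter> {..<t})"
  and pldD_right: "pld f \<Longrightarrow> t \<in> kappa I \<Longrightarrow> right_dense I t \<Longrightarrow> \<exists>l. (f \<longlongrightarrow> l) (at t within kappa I \<inter> {t<..})"
  unfolding piecewise_ld_continuous_on_def by blast+

text \<open>Left-dense points of \<open>I\<close> inherit the limit through the ceiling map; at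
  every other real point the extension is locally constant on this side.\<close>

lemma pld_ceil_left:
  assumes "pld f" "a < x" "x \<le> b"
  shows "\<exists>l. ((\<lambda>s. f (up s)) \<longlongrightarrow> l) (at_left x)"
proof (cases "x \<in> I \<and> left_dense I x")
  case True
  with assms pldD_left[OF assms(1), of x] kappa_I obtain l
    where l: "(f \<longlongrightarrow> l) (at x within kappa I \<inter> {..<x})" by blast
  from filterlim_compose[OF l filterlim_ceil_left] True assms show ?thesis by blast
next
  case False
  have "\<forall>\<^sub>F s in at_left x. f (up s) = f (up x)"
    using ceil_eventually_const_left[OF assms(2,3) False] by eventually_elim simp
  then show ?thesis by (blast intro: tendsto_eventually)
qed

lemma pld_ceil_right:
  assumes "pld f" "a \<le> x" "x < b"
  shows "\<exists>l. ((\<lambda>s. f (up s)) \<longlongrightarrow> l) (at_right x)"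
proof (cases "x \<in> I \<and> right_dense I x")
  case True
  with assms have "x \<in> kappa I" using kappa_I a_kappa_iff by (metis order_le_less)
  with True assms pldD_right[OF assms(1), of x] obtain l
    where l: "(f \<longlongrightarrow> l) (at x within kappa I \<inter> {x<..})" by blast
  from filterlim_compose[OF l filterlim_ceil_right] True assms show ?thesis by blast
next
  case False
  from ceil_eventually_const_right[OF assms(2,3) False] obtain t where
    "\<forall>\<^sub>F s in at_right x. up s = t" by blast
  then have "\<forall>\<^sub>F s in at_right x. f (up s) = f t" by eventually_elim simp
  then show ?thesis by (blast intro: tendsto_eventually)
qed

lemma pld_integrable:
  assumes "pld f" shows "(\<lambda>s. f (up s)) integrable_on {a..b}"
  using a_less_b pld_ceil_left[OF assms] pld_ceil_right[OF assms]
  by (intro left_right_limits_imp_integrable) auto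

lemma pld_bounded:
  assumes "pld f" shows "\<exists>M. \<forall>s\<in>{a..b}. \<bar>f (up s)\<bar> \<le> M"
  using a_less_b pld_ceil_left[OF assms] pld_ceil_right[OF assms]
  by (intro left_right_limits_imp_bounded) auto

lemma ld_imp_pld:
  assumes "ld_continuous_on I (kappa I) f" shows "pld f"
  unfolding piecewise_ld_continuous_on_def
proof (intro conjI ballI impI exI[of _ "{}"])
  fix t assume t: "t \<in> kappa I"
  show "\<exists>l. (f \<longlongrightarrow> l) (at t within kappa I \<inter> {..<t})" if "left_dense I t"
  proof -
    have "(f \<longlongrightarrow> f t) (at t within kappa I)"
      using assms t that by (auto simp: ld_continuous_on_def ld_continuous_at_def continuous_within)
    then show ?thesis by (meson tendsto_within_subset Int_lower1)
  qed
  show "\<exists>l. (f \<longlongrightarrow> l) (at t within kappa I \<inter> {t<..})" if "right_dense I t"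
    using assms t that by (auto simp: ld_continuous_on_def ld_continuous_at_def)
qed (use assms in \<open>auto simp: ld_continuous_on_def\<close>)

end

section \<open>Nabla derivatives and integrals\<close>

lemma indefinite_integral_left_derivative:
  fixes h :: "real \<Rightarrow> real"
  assumes h: "h integrable_on {a..b}" and "a < t" "t \<le> b" and l: "(h \<longlongrightarrow> l) (at_left t)"
  shows "((\<lambda>x. integral {a..x} h) has_real_derivative l) (at t within {a..t})"
proof -
  \<comment> \<open>Replacing the value at \<open>t\<close> by the limit leaves all integrals
    unchanged and makes the integrand continuous from the left, so that the fundamental theorem
    applies.\<close>
  define h' where "h' = h(t := l)"
  have eq: "integral {a..x} h' = integral {a..x} h" for x
    by (rule integral_spike[of "{t}"]) (auto simp: h'_def)
  have "h integrable_on {a..t}"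
    using h assms(2,3) by (elim integrable_on_subinterval) auto
  then have "h' integrable_on {a..t}"
    by (rule integrable_spike_finite[of "{t}", rotated 2]) (auto simp: h'_def)
  moreover have "continuous (at t within {a..t} - {}) h'"
  proof -
    have "(h' \<longlongrightarrow> l) (at_left t)"
      by (rule Lim_transform_eventually[OF l]) (auto simp: h'_def eventually_at_topological)
    moreover have "h' t = l" by (simp add: h'_def)
    ultimately show ?thesis
      using \<open>a < t\<close> by (simp add: continuous_within at_within_Icc_at_left)
  qed
  ultimately have "((\<lambda>x. integral {a..x} h') has_vector_derivative h' t) (at t within {a..t} - {})"
    using \<open>a < t\<close> by (intro integral_has_vector_derivative_continuous_at) auto
  then show ?thesis
    unfolding eq by (simp add: has_real_derivative_iff_has_vector_derivative h'_def)
qed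

lemma indefinite_integral_right_derivative:
  fixes h :: "real \<Rightarrow> real"
  assumes h: "h integrable_on {a..b}" and "a \<le> t" "t < b" and l: "(h \<longlongrightarrow> l) (at_right t)"
  shows "((\<lambda>x. integral {a..x} h) has_real_derivative l) (at t within {t..b})"
proof -
  define h' where "h' = h(t := l)"
  have eq: "integral {t..x} h' = integral {t..x} h" for x
    by (rule integral_spike[of "{t}"]) (auto simp: h'_def)
  have "h integrable_on {t..b}"
    using h assms(2,3) by (elim integrable_on_subinterval) auto
  then have "h' integrable_on {t..b}"
    by (rule integrable_spike_finite[of "{t}", rotated 2]) (auto simp: h'_def)
  moreover have "continuous (at t within {t..b} - {}) h'"
  proof -
    have "(h' \<longlongrightarrow> l) (at_right t)"
      by (rule Lim_transform_eventually[OF l]) (auto simp: h'_def eventually_at_topological)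
    moreover have "h' t = l" by (simp add: h'_def)
    ultimately show ?thesis
      using \<open>t < b\<close> by (simp add: continuous_within at_within_Icc_at_right)
  qed
  ultimately have "((\<lambda>x. integral {t..x} h') has_vector_derivative h' t) (at t within {t..b} - {})"
    using \<open>t < b\<close> by (intro integral_has_vector_derivative_continuous_at) auto
  then have "((\<lambda>x. integral {t..x} h) has_real_derivative l) (at t within {t..b})"
    unfolding eq by (simp add: has_real_derivative_iff_has_vector_derivative h'_def)
  then have *: "((\<lambda>x. integral {a..t} h + integral {t..x} h) has_real_derivative l) (at t within {t..b})"
    by (auto intro!: derivative_eq_intros)
  show ?thesis
  proof (rule has_field_derivative_transform_within[OF * zero_less_one])
    show "t \<in> {t..b}" using \<open>t < b\<close> by simp
    fix x assume "x \<in> {t..b}"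
    moreover from this have "h integrable_on {a..x}"
      using h \<open>a \<le> t\<close> by (elim integrable_on_subinterval) auto
    ultimately show "integral {a..t} h + integral {t..x} h = integral {a..x} h"
      using \<open>a \<le> t\<close> by (intro Henstock_Kurzweil_Integration.integral_combine) auto
  qed
qed

section \<open>Calculus of the nabla derivative\<close>

context compact_time_scale
begin

text \<open>The ceiling map sends the nontrivial filter \<open>at_left t\<close> into this
  one.\<close>

lemma at_left_kappa_neq_bot:
  assumes "t \<in> I" "a < t" "left_dense I t"
  shows "at t within kappa I \<inter> {..<t} \<noteq> bot"
  using filterlim_ceil_left[OF assms] by (auto simp: filterlim_def bot_unique filtermap_bot_iff)

lemma at_right_kappa_neq_bot:
  assumes "t \<in> I" "t < b" "right_dense I t"
  shows "at t within kappa I \<inter> {t<..} \<noteq> bot"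
  using filterlim_ceil_right[OF assms] by (auto simp: filterlim_def bot_unique filtermap_bot_iff)

lemma at_left_dense_neq_bot:
  assumes "t \<in> kappa I" "left_dense I t"
  shows "at t within I \<noteq> bot"
proof -
  have "at t within kappa I \<inter> {..<t} \<noteq> bot \<or> at t within kappa I \<inter> {t<..} \<noteq> bot"
    using kappa_cases[OF assms(1)] assms at_left_kappa_neq_bot at_right_kappa_neq_bot a_in a_less_b
    by blast
  moreover have "at t within kappa I \<inter> A \<le> at t within I" for A
    using kappa_subset by (intro at_le) auto
  ultimately show ?thesis using bot_unique by metis
qed

text \<open>With \<open>rh t = t\<close> the definition is the epsilon form of the ordinary
  derivative within \<open>I\<close>.\<close>

lemma left_dense_has_nabla_deriv_iff:
  assumes "left_dense I t"
  shows "has_nabla_deriv I F t \<beta> \<longleftrightarrow> t \<in> kappa I \<and> (F has_real_derivative \<beta>) (at t within I)"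
proof -
  have "\<bar>F t - F s - \<beta> * (t - s)\<bar> = \<bar>F s - F t - \<beta> * (s - t)\<bar>" for s
    by (simp add: algebra_simps abs_minus_commute)
  moreover have "\<bar>t - s\<bar> = \<bar>s - t\<bar>" for s by simp
  ultimately have "(\<exists>U. open U \<and> t \<in> U \<and> (\<forall>s\<in>U \<inter> I. \<bar>F t - F s - \<beta> * (t - s)\<bar> \<le> \<epsilon> * \<bar>t - s\<bar>))
    \<longleftrightarrow> (\<forall>\<^sub>F s in at t within I. \<bar>F s - F t - \<beta> * (s - t)\<bar> \<le> \<epsilon> * \<bar>s - t\<bar>)" for \<epsilon>
    unfolding eventually_at_topological
    by (intro iff_exI conj_cong refl) (simp, metis IntE IntI abs_zero diff_self mult_zero_right order_refl)
  then show ?thesis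
    using assms
    by (simp add: has_nabla_deriv_def left_dense_def has_field_derivative_def
        has_derivative_within_alt2 bounded_linear_mult_right)
qed

text \<open>At \<open>s = t\<close> the defining inequality holds with room
  \<open>e * (t - rh t)\<close>, and continuity carries it to a neighbourhood.\<close>

lemma left_scattered_has_nabla_deriv:
  assumes "t \<in> I" "\<not> left_dense I t" and F: "continuous (at t within I) F"
  shows "has_nabla_deriv I F t ((F t - F (rh t)) / (t - rh t))"
  unfolding has_nabla_deriv_def
proof (intro conjI allI impI)
  let ?d = "(F t - F (rh t)) / (t - rh t)"
  note lt = not_left_denseD[OF assms(1,2)]
  show "t \<in> kappa I" using kappa_I assms lt by blast
  fix e :: real assume "e > 0"
  let ?g = "\<lambda>s. \<bar>F (rh t) - F s - ?d * (rh t - s)\<bar> - e * \<bar>rh t - s\<bar>"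
  have "(?g \<longlongrightarrow> ?g t) (at t within I)"
    using F unfolding continuous_within by (intro tendsto_intros)
  moreover have gt: "?g t < 0"
  proof -
    have "?d * (rh t - t) = F (rh t) - F t" using lt by (simp add: field_simps)
    then show ?thesis using \<open>e > 0\<close> lt by simp
  qed
  ultimately have "\<forall>\<^sub>F s in at t within I. ?g s < 0" by (rule order_tendstoD(2))
  then obtain U where U: "open U" "t \<in> U" "\<And>s. s \<in> U \<Longrightarrow> s \<noteq> t \<Longrightarrow> s \<in> I \<Longrightarrow> ?g s < 0"
    unfolding eventually_at_topological by blast
  show "\<exists>U. open U \<and> t \<in> U \<and> (\<forall>s\<in>U \<inter> I. \<bar>F (rh t) - F s - ?d * (rh t - s)\<bar> \<le> e * \<bar>rh t - s\<bar>)"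
  proof (intro exI[of _ U] conjI ballI)
    fix s assume "s \<in> U \<inter> I"
    then have "?g s < 0" using gt U(3)[of s] by (cases "s = t") blast+
    then show "\<bar>F (rh t) - F s - ?d * (rh t - s)\<bar> \<le> e * \<bar>rh t - s\<bar>" by linarith
  qed (use U in auto)
qed

text \<open>The defining inequality is evaluated at \<open>s = t\<close> and \<open>e\<close> tends
  to zero; at a left-dense point both sides vanish.\<close>

lemma has_nabla_deriv_increment:
  assumes "t \<in> I" "has_nabla_deriv I F t \<beta>"
  shows "F t - F (rh t) = \<beta> * (t - rh t)"
proof -
  have "\<bar>F (rh t) - F t - \<beta> * (rh t - t)\<bar> \<le> e * \<bar>rh t - t\<bar>" if "e > 0" for e
    using assms that unfolding has_nabla_deriv_def by (meson IntI)
  then have le: "\<bar>F (rh t) - F t - \<beta> * (rh t - t)\<bar> \<le> e * (t - rh t)" if "e > 0" for e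
    using rho_le[OF assms(1)] that by simp
  show ?thesis
  proof (cases "rh t = t")
    case False
    with rho_le[OF assms(1)] have pos: "t - rh t > 0" by simp
    have "\<bar>F (rh t) - F t - \<beta> * (rh t - t)\<bar> \<le> 0 + e" if "e > 0" for e
      using le[of "e / (t - rh t)"] pos that by simp
    then have "\<bar>F (rh t) - F t - \<beta> * (rh t - t)\<bar> \<le> 0" by (rule field_le_epsilon)
    then show ?thesis by (simp add: algebra_simps)
  qed simp
qed

lemma has_nabla_deriv_unique:
  assumes "has_nabla_deriv I F t \<beta>" "has_nabla_deriv I F t \<gamma>"
  shows "\<beta> = \<gamma>"
proof -
  have t: "t \<in> kappa I" using assms by (simp add: has_nabla_deriv_def)
  show ?thesis
  proof (cases "left_dense I t")
    case True
    with assms t vector_derivative_unique_within[OF at_left_dense_neq_bot] show ?thesis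
      by (meson has_real_derivative_iff_has_vector_derivative left_dense_has_nabla_deriv_iff)
  next
    case False
    then show ?thesis
      using has_nabla_deriv_increment[OF _ assms(1)] has_nabla_deriv_increment[OF _ assms(2)]
        t kappa_subset not_left_denseD[of t] by auto
  qed
qed

lemma nabla_deriv_eq: "has_nabla_deriv I F t \<beta> \<Longrightarrow> nabla_deriv I F t = \<beta>"
  unfolding nabla_deriv_def using has_nabla_deriv_unique by (intro the_equality)

lemma has_nabla_deriv_nabla_deriv:
  "nabla_differentiable I F t \<Longrightarrow> has_nabla_deriv I F t (nabla_deriv I F t)"
  using nabla_deriv_eq by (auto simp: nabla_differentiable_def)

lemma has_nabla_deriv_diff:
  assumes "has_nabla_deriv I F t \<beta>" "has_nabla_deriv I G t \<gamma>"
  shows "has_nabla_deriv I (\<lambda>s. F s - G s) t (\<beta> - \<gamma>)"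
  unfolding has_nabla_deriv_def
proof (intro conjI allI impI)
  show "t \<in> kappa I" using assms by (simp add: has_nabla_deriv_def)
  fix e :: real assume "e > 0"
  then have e: "e / 2 > 0" by simp
  from assms(1) e obtain U where U: "open U" "t \<in> U"
    "\<And>s. s \<in> U \<inter> I \<Longrightarrow> \<bar>F (rh t) - F s - \<beta> * (rh t - s)\<bar> \<le> e / 2 * \<bar>rh t - s\<bar>"
    unfolding has_nabla_deriv_def by meson
  from assms(2) e obtain V where V: "open V" "t \<in> V"
    "\<And>s. s \<in> V \<inter> I \<Longrightarrow> \<bar>G (rh t) - G s - \<gamma> * (rh t - s)\<bar> \<le> e / 2 * \<bar>rh t - s\<bar>"
    unfolding has_nabla_deriv_def by meson
  show "\<exists>U. open U \<and> t \<in> U \<and> (\<forall>s\<in>U \<inter> I.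
      \<bar>F (rh t) - G (rh t) - (F s - G s) - (\<beta> - \<gamma>) * (rh t - s)\<bar> \<le> e * \<bar>rh t - s\<bar>)"
  proof (intro exI[of _ "U \<inter> V"] conjI ballI)
    fix s assume s: "s \<in> U \<inter> V \<inter> I"
    have "F (rh t) - G (rh t) - (F s - G s) - (\<beta> - \<gamma>) * (rh t - s)
      = (F (rh t) - F s - \<beta> * (rh t - s)) - (G (rh t) - G s - \<gamma> * (rh t - s))"
      by (simp add: algebra_simps)
    moreover have "e * \<bar>rh t - s\<bar> = e / 2 * \<bar>rh t - s\<bar> + e / 2 * \<bar>rh t - s\<bar>" by simp
    moreover have "\<bar>F (rh t) - F s - \<beta> * (rh t - s)\<bar> \<le> e / 2 * \<bar>rh t - s\<bar>"
      "\<bar>G (rh t) - G s - \<gamma> * (rh t - s)\<bar> \<le> e / 2 * \<bar>rh t - s\<bar>"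
      using U(3)[of s] V(3)[of s] s by blast+
    ultimately show "\<bar>F (rh t) - G (rh t) - (F s - G s) - (\<beta> - \<gamma>) * (rh t - s)\<bar> \<le> e * \<bar>rh t - s\<bar>"
      using abs_triangle_ineq4[of "F (rh t) - F s - \<beta> * (rh t - s)" "G (rh t) - G s - \<gamma> * (rh t - s)"]
      by linarith
  qed (use U V in auto)
qed

section \<open>Indefinite integrals as nabla antiderivatives\<close>

lemma pld_indefinite_integral_continuous:
  assumes "pld f" shows "continuous_on {a..b} (\<lambda>x. integral {a..x} (\<lambda>s. f (up s)))"
  by (rule indefinite_integral_continuous_1[OF pld_integrable[OF assms]])

lemma pld_indefinite_integral_left_derivative:
  assumes "pld f" "t \<in> I" "a < t" "left_dense I t" "(f \<longlongrightarrow> l) (at t within kappa I \<inter> {..<t})"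
  shows "((\<lambda>x. integral {a..x} (\<lambda>s. f (up s))) has_real_derivative l) (at t within I \<inter> {..t})"
proof (rule has_field_derivative_subset)
  show "((\<lambda>x. integral {a..x} (\<lambda>s. f (up s))) has_real_derivative l) (at t within {a..t})"
    using assms filterlim_compose[OF assms(5) filterlim_ceil_left] le_b
    by (intro indefinite_integral_left_derivative[OF pld_integrable]) auto
  show "I \<inter> {..t} \<subseteq> {a..t}" using ge_a by auto
qed

lemma pld_indefinite_integral_right_derivative:
  assumes "pld f" "t \<in> I" "t < b" "right_dense I t" "(f \<longlongrightarrow> l) (at t within kappa I \<inter> {t<..})"
  shows "((\<lambda>x. integral {a..x} (\<lambda>s. f (up s))) has_real_derivative l) (at t within I \<inter> {t..})"
proof (rule has_field_derivative_subset)
  show "((\<lambda>x. integral {a..x} (\<lambda>s. f (up s))) has_real_derivative l) (at t within {t..b})"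
    using assms filterlim_compose[OF assms(5) filterlim_ceil_right] ge_a
    by (intro indefinite_integral_right_derivative[OF pld_integrable]) auto
  show "I \<inter> {t..} \<subseteq> {t..b}" using le_b by auto
qed

lemma has_derivative_two_sided:
  assumes "(F has_real_derivative l) (at t within I \<inter> {..t})"
    and "(F has_real_derivative l) (at t within I \<inter> {t..})"
  shows "(F has_real_derivative l) (at t within I)"
proof -
  have "(F has_real_derivative l) (at t within (I \<inter> {..t}) \<union> (I \<inter> {t..}))"
    using assms unfolding has_field_derivative_iff by (rule Lim_Un)
  moreover have "(I \<inter> {..t}) \<union> (I \<inter> {t..}) = I" by auto
  ultimately show ?thesis by simp
qed

lemma right_gap:
  assumes "t \<in> I" "\<not> (t < b \<and> right_dense I t)"
  shows "\<exists>c>t. \<forall>s\<in>I. t < s \<longrightarrow> c \<le> s"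
proof (cases "t < b")
  case True
  with assms not_right_denseD show ?thesis by blast
next
  case False
  with le_b show ?thesis by (metis gt_ex less_le_trans order_less_irrefl not_less)
qed

lemma left_gap:
  assumes "t \<in> I" "\<not> (a < t \<and> left_dense I t)"
  shows "\<exists>c<t. \<forall>s\<in>I. s < t \<longrightarrow> s \<le> c"
proof (cases "a < t")
  case True
  with assms show ?thesis using not_left_denseD[of t] le_rho by blast
next
  case False
  with ge_a show ?thesis by (metis lt_ex less_le_trans order_less_irrefl not_less)
qed

text \<open>No point of \<open>I\<close> accumulates at \<open>t\<close> from the right, so the
  filter is trivial and every \<open>l\<close> qualifies. The point \<open>b\<close> and
  right-scattered points can thus be glued in the same way as right-dense ones.\<close>

lemma has_derivative_right_trivial:
  assumes "t \<in> I" "\<not> (t < b \<and> right_dense I t)"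
  shows "(F has_real_derivative l) (at t within I \<inter> {t..})"
proof -
  obtain c where c: "c > t" "\<And>s. s \<in> I \<Longrightarrow> t < s \<Longrightarrow> c \<le> s" using right_gap[OF assms] by blast
  have "at t within I \<inter> {t..} = bot"
    unfolding trivial_limit_def eventually_at
    by (rule exI[of _ "c - t"]) (use c in \<open>force simp: dist_real_def\<close>)
  then show ?thesis by (simp add: has_field_derivative_iff)
qed

lemma has_derivative_left_trivial: "(F has_real_derivative l) (at a within I \<inter> {..a})"
proof -
  have "I \<inter> {..a} = {a}" using a_in ge_a by force
  moreover have "at a within {a} = bot"
    by (auto simp: trivial_limit_def eventually_at intro: exI[of _ 1])
  ultimately show ?thesis by (simp add: has_field_derivative_iff)
qed

text \<open>The extension equals \<open>f t\<close> on \<open>(rh t, t]\<close>, so the integral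
  over the gap is a rectangle, of width zero if \<open>t\<close> is left-dense.\<close>

lemma integral_ceil_gap:
  assumes "t \<in> I" "pld f"
  shows "integral {a..t} (\<lambda>s. f (up s)) - integral {a..rh t} (\<lambda>s. f (up s)) = f t * (t - rh t)"
proof -
  have r: "a \<le> rh t" "rh t \<le> t" "t \<le> b"
    using rho_mem rho_le ge_a le_b assms by auto
  have "(\<lambda>s. f (up s)) integrable_on {a..t}"
    using pld_integrable[OF assms(2)] r by (elim integrable_on_subinterval) auto
  then have "integral {a..t} (\<lambda>s. f (up s)) - integral {a..rh t} (\<lambda>s. f (up s))
    = integral {rh t..t} (\<lambda>s. f (up s))"
    using Henstock_Kurzweil_Integration.integral_combine[OF r(1,2), of "\<lambda>s. f (up s)"] by linarith
  also have "\<dots> = integral {rh t..t} (\<lambda>s. f t)"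
    by (rule integral_spike[of "{rh t}"]) (use ceil_gap[OF assms(1)] in auto)
  finally show ?thesis using r by simp
qed

text \<open>Continuity is asked at left-dense points only: at a left-scattered point the derivative
  is the rectangle over the gap divided by its width. At a left-dense point the two one-sided
  derivatives are glued.\<close>

lemma pld_indefinite_integral_nabla_deriv:
  assumes f: "pld f" and t: "t \<in> kappa I" and c: "left_dense I t \<Longrightarrow> continuous (at t within kappa I) f"
  shows "has_nabla_deriv I (\<lambda>x. C + integral {a..x} (\<lambda>s. f (up s))) t (f t)"
proof (cases "left_dense I t")
  case True
  then have lim: "(f \<longlongrightarrow> f t) (at t within kappa I)" using c by (simp add: continuous_within)
  let ?F = "\<lambda>x. integral {a..x} (\<lambda>s. f (up s))"
  have tI: "t \<in> I" using t kappa_subset by blast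
  have "(?F has_real_derivative f t) (at t within I)"
  proof (rule has_derivative_two_sided)
    show "(?F has_real_derivative f t) (at t within I \<inter> {..t})"
    proof (cases "t = a")
      case True
      then show ?thesis by (simp add: has_derivative_left_trivial)
    next
      case False
      with tI ge_a have "a < t" by force
      with tI True lim show ?thesis
        by (intro pld_indefinite_integral_left_derivative[OF f]) (auto intro: tendsto_within_subset)
    qed
    show "(?F has_real_derivative f t) (at t within I \<inter> {t..})"
    proof (cases "t < b \<and> right_dense I t")
      case True
      with tI lim show ?thesis
        by (intro pld_indefinite_integral_right_derivative[OF f]) (auto intro: tendsto_within_subset)
    next
      case False
      then show ?thesis by (rule has_derivative_right_trivial[OF tI])
    qed
  qed
  then have "((\<lambda>x. C + ?F x) has_real_derivative f t) (at t within I)"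
    by (auto intro!: derivative_eq_intros)
  with True t show ?thesis by (simp add: left_dense_has_nabla_deriv_iff)
next
  case False
  let ?F = "\<lambda>x. C + integral {a..x} (\<lambda>s. f (up s))"
  have tI: "t \<in> I" using t kappa_subset by blast
  have "continuous_on I ?F"
    using continuous_on_subset[OF pld_indefinite_integral_continuous[OF f] I_subset]
    by (intro continuous_intros)
  then have "continuous (at t within I) ?F" using tI by (simp add: continuous_on_eq_continuous_within)
  from left_scattered_has_nabla_deriv[OF tI False this]
  have "has_nabla_deriv I ?F t ((?F t - ?F (rh t)) / (t - rh t))" .
  moreover have "(?F t - ?F (rh t)) / (t - rh t) = f t"
    using integral_ceil_gap[OF tI f] not_left_denseD[OF tI False] by simp
  ultimately show ?thesis by metis
qed

text \<open>Backward induction: a vanishing nabla derivative controls \<open>G\<close> to the left of a point, whereas it says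
  nothing about the right of a left-scattered, right-dense point.\<close>

lemma nabla_deriv_zero_imp_constant:
  assumes G: "continuous_on I G" and "finite S" and S: "\<And>t. t \<in> S \<Longrightarrow> left_dense I t"
    and D: "\<And>t. t \<in> kappa I - S \<Longrightarrow> has_nabla_deriv I G t 0"
    and "u \<in> I"
  shows "G u = G b"
proof -
  \<comment> \<open>Error budget to the right of \<open>u\<close>: slope \<open>e\<close> all the
    way, and one extra \<open>e\<close> for each exceptional point, where only continuity of
    \<open>G\<close> is available.\<close>
  define B where "B e u = e * (b - u) + e * real (card (S \<inter> {u<..b}))" for e u :: real
  have B_mono: "B e v \<le> B e u" if "e > 0" "u \<le> v" for e u v
    unfolding B_def using that \<open>finite S\<close>
    by (intro add_mono mult_left_mono of_nat_mono card_mono) auto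
  have key: "\<bar>G b - G u\<bar> \<le> B e u" if "e > 0" "u \<in> I" for e u
  proof -
    define Z where "Z = {s \<in> I. \<forall>u\<in>I. s \<le> u \<longrightarrow> \<bar>G b - G u\<bar> \<le> B e u}"
    have "\<bar>G b - G u\<bar> \<le> B e u" if "u \<in> I" "b \<le> u" for u
      using le_b[OF that(1)] that \<open>e > 0\<close> by (simp add: B_def)
    then have "b \<in> Z" using b_in by (simp add: Z_def)
    define z where "z = Inf Z"
    have "Z \<subseteq> I" by (auto simp: Z_def)
    then have zI: "z \<in> I" unfolding z_def using \<open>b \<in> Z\<close> by (intro Inf_mem) auto
    have bdd: "bdd_below Z" unfolding Z_def by (rule bdd_I)
    have z_le: "z \<le> s" if "s \<in> Z" for s
      unfolding z_def using that bdd by (rule cInf_lower)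
    have above: "\<bar>G b - G u\<bar> \<le> B e u" if u: "u \<in> I" "z < u" for u
    proof -
      obtain s where "s \<in> Z" "s < u" using cInf_lessD[of Z u] u \<open>b \<in> Z\<close> unfolding z_def by blast
      then show ?thesis using u by (auto simp: Z_def)
    qed
    have cont: "\<exists>d>0. \<forall>s\<in>I. \<bar>s - z\<bar> < d \<longrightarrow> \<bar>G s - G z\<bar> < r" if "r > 0" for r
      using G zI that unfolding continuous_on_iff dist_real_def by blast
    \<comment> \<open>Unless \<open>z\<close> is in \<open>Z\<close> already, points of
      \<open>Z\<close> approach it from the right, and the bound survives by continuity of
      \<open>G\<close>.\<close>
    have "\<bar>G b - G z\<bar> \<le> B e z"
    proof (cases "z \<in> Z")
      case True
      then show ?thesis by (auto simp: Z_def)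
    next
      case False
      show ?thesis
      proof (rule field_le_epsilon)
        fix r :: real assume "r > 0"
        then obtain d where d: "d > 0" "\<And>s. s \<in> I \<Longrightarrow> \<bar>s - z\<bar> < d \<Longrightarrow> \<bar>G s - G z\<bar> < r"
          using cont by blast
        obtain s where s: "s \<in> Z" "s < z + d" using cInf_lessD[of Z "z + d"] d \<open>b \<in> Z\<close> unfolding z_def by force
        then have "s \<in> I" "z < s" using z_le[of s] False by (auto simp: Z_def order_le_less)
        then have "\<bar>G s - G z\<bar> < r" "\<bar>G b - G s\<bar> \<le> B e s" "B e s \<le> B e z"
          using d(2)[of s] s(2) above B_mono \<open>e > 0\<close> by auto
        then show "\<bar>G b - G z\<bar> \<le> B e z + r" by linarith
      qed
    qed
    with above have zZ: "z \<in> Z" by (auto simp: Z_def zI order_le_less)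
    have "z = a"
    proof (rule ccontr)
      assume "z \<noteq> a"
      with ge_a zI have az: "a < z" by force
      then have zk: "z \<in> kappa I" using kappa_I zI by blast
      \<comment> \<open>Minimality of \<open>z\<close>: the bound on a stretch \<open>[s, z)\<close>
        would put \<open>s < z\<close> into \<open>Z\<close>.\<close>
      have contra: False if s: "s \<in> I" "s < z" and "\<And>u. u \<in> I \<Longrightarrow> s \<le> u \<Longrightarrow> u < z \<Longrightarrow> \<bar>G b - G u\<bar> \<le> B e u" for s
      proof -
        have "\<bar>G b - G u\<bar> \<le> B e u" if "u \<in> I" "s \<le> u" for u
          using \<open>\<And>u. u \<in> I \<Longrightarrow> s \<le> u \<Longrightarrow> u < z \<Longrightarrow> \<bar>G b - G u\<bar> \<le> B e u\<close>[of u] that zZ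
          by (cases "u < z") (auto simp: Z_def)
        then have "s \<in> Z" using s by (simp add: Z_def)
        with z_le[of s] s show False by simp
      qed
      show False
      proof (cases "left_dense I z")
        case False
        have "G z = G (rh z)" using has_nabla_deriv_increment[OF zI D] zk S False by auto
        moreover have "\<bar>G b - G z\<bar> \<le> B e z" using zZ zI by (auto simp: Z_def)
        moreover have "B e z \<le> B e (rh z)" using B_mono \<open>e > 0\<close> rho_le zI by blast
        ultimately have "\<bar>G b - G (rh z)\<bar> \<le> B e (rh z)" by linarith
        then show False
          using contra[of "rh z"] rho_mem zI not_left_denseD[OF zI False] le_rho[OF _ zI]
          by (metis order_antisym)
      next
        case True
        have "\<exists>d>0. \<forall>s\<in>I. z - d < s \<longrightarrow> s < z \<longrightarrow> \<bar>G b - G s\<bar> \<le> B e s"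
        proof (cases "z \<in> S")
          case False
          then obtain U where U: "open U" "z \<in> U" "\<And>s. s \<in> U \<inter> I \<Longrightarrow> \<bar>G (rh z) - G s - 0 * (rh z - s)\<bar> \<le> e * \<bar>rh z - s\<bar>"
            using D[of z] zk \<open>e > 0\<close> unfolding has_nabla_deriv_def by (metis DiffI)
          then obtain d where d: "d > 0" "\<And>s. \<bar>s - z\<bar> < d \<Longrightarrow> s \<in> U"
            unfolding open_dist dist_real_def by blast
          have "\<bar>G b - G s\<bar> \<le> B e s" if s: "s \<in> I" "z - d < s" "s < z" for s
          proof -
            have "s \<in> U \<inter> I" using d(2) s by auto
            then have "\<bar>G z - G s\<bar> \<le> e * (z - s)" using U(3)[of s] True s by (simp add: left_dense_def)
            moreover have "\<bar>G b - G z\<bar> \<le> B e z" using zZ zI by (auto simp: Z_def)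
            moreover have "B e z + e * (z - s) \<le> B e s"
            proof -
              have "real (card (S \<inter> {z<..b})) \<le> real (card (S \<inter> {s<..b}))"
                using \<open>finite S\<close> s by (intro of_nat_mono card_mono) auto
              then have "e * real (card (S \<inter> {z<..b})) \<le> e * real (card (S \<inter> {s<..b}))"
                using \<open>e > 0\<close> by simp
              then show ?thesis by (simp add: B_def algebra_simps)
            qed
            ultimately show ?thesis by linarith
          qed
          with d show ?thesis by blast
        next
          case True
          from cont[OF \<open>e > 0\<close>] obtain d where d: "d > 0" "\<And>s. s \<in> I \<Longrightarrow> \<bar>s - z\<bar> < d \<Longrightarrow> \<bar>G s - G z\<bar> < e"
            by blast
          have "\<bar>G b - G s\<bar> \<le> B e s" if s: "s \<in> I" "z - d < s" "s < z" for s
          proof -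
            have "\<bar>G s - G z\<bar> < e" using d(2) s by auto
            moreover have "\<bar>G b - G z\<bar> \<le> B e z" using zZ zI by (auto simp: Z_def)
            moreover have "B e z + e \<le> B e s"
            proof -
              \<comment> \<open>\<open>z\<close> is counted in \<open>{s<..b}\<close> but not in
                \<open>{z<..b}\<close>, so the extra \<open>e\<close> is released exactly when
                \<open>z\<close> is passed.\<close>
              have "card (insert z (S \<inter> {z<..b})) \<le> card (S \<inter> {s<..b})"
                using \<open>finite S\<close> s True le_b[OF zI] by (intro card_mono) auto
              then have "real (card (S \<inter> {z<..b})) + 1 \<le> real (card (S \<inter> {s<..b}))"
                using \<open>finite S\<close> by simp
              then have "e * (real (card (S \<inter> {z<..b})) + 1) \<le> e * real (card (S \<inter> {s<..b}))"
                using \<open>e > 0\<close> by simp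
              moreover have "e * z \<ge> e * s" using s \<open>e > 0\<close> by simp
              ultimately show ?thesis by (simp add: B_def algebra_simps)
            qed
            ultimately show ?thesis by linarith
          qed
          with d show ?thesis by blast
        qed
        then obtain d where d: "d > 0" "\<And>s. s \<in> I \<Longrightarrow> z - d < s \<Longrightarrow> s < z \<Longrightarrow> \<bar>G b - G s\<bar> \<le> B e s"
          by blast
        obtain s where "s \<in> I" "z - d < s" "s < z" using left_denseD[OF zI az True, of "z - d"] d by auto
        then show False using contra[of s] d(2) by force
      qed
    qed
    with zZ \<open>u \<in> I\<close> ge_a show ?thesis by (auto simp: Z_def)
  qed
  have "\<bar>G b - G u\<bar> \<le> 0 + r" if "r > 0" for r
  proof -
    \<comment> \<open>Total weight of the budget, plus one to keep the divisor positive at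
      \<open>u = b\<close> too.\<close>
    define K where "K = (b - u) + real (card (S \<inter> {u<..b})) + 1"
    have "K > 0" using le_b[OF \<open>u \<in> I\<close>] by (simp add: K_def)
    have "K - 1 = (b - u) + real (card (S \<inter> {u<..b}))" by (simp add: K_def)
    then have "B (r / K) u = r / K * (K - 1)" unfolding B_def by (simp only: distrib_left)
    also have "\<dots> \<le> r" using \<open>K > 0\<close> \<open>r > 0\<close> by (simp add: field_simps)
    finally show ?thesis using key[of "r / K" u] \<open>K > 0\<close> \<open>r > 0\<close> \<open>u \<in> I\<close> by simp
  qed
  then have "\<bar>G b - G u\<bar> \<le> 0" by (rule field_le_epsilon)
  then show ?thesis by simp
qed

text \<open>The difference of the two sides has vanishing nabla derivative off the union of both
  exceptional sets, so it is constant, and it is zero at \<open>a\<close>. This is the uniqueness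
  behind the definite description in \<open>nabla_integral\<close>.\<close>

lemma antiderivative_eq_integral:
  assumes F: "continuous_on I F" and f: "pld f" and "finite S" and S: "\<And>t. t \<in> S \<Longrightarrow> left_dense I t"
    and D: "\<And>t. t \<in> kappa I - S \<Longrightarrow> has_nabla_deriv I F t (f t)"
    and "u \<in> I"
  shows "F u = F a + integral {a..u} (\<lambda>s. f (up s))"
proof -
  obtain S' where S': "finite S'" "\<And>t. t \<in> S' \<Longrightarrow> left_dense I t" "\<And>t. t \<in> kappa I - S' \<Longrightarrow> ld_continuous_at I (kappa I) f t"
    using f unfolding piecewise_ld_continuous_on_def by blast
  let ?G = "\<lambda>u. F u - (F a + integral {a..u} (\<lambda>s. f (up s)))"
  have "?G u = ?G b" if "u \<in> I" for u
  proof (rule nabla_deriv_zero_imp_constant[where S = "S \<union> S'"])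
    show "continuous_on I ?G"
      using F continuous_on_subset[OF pld_indefinite_integral_continuous[OF f] I_subset]
      by (intro continuous_intros)
    show "has_nabla_deriv I ?G t 0" if t: "t \<in> kappa I - (S \<union> S')" for t
    proof -
      have "has_nabla_deriv I ?G t (f t - f t)"
        using t D[of t] S'(3)[of t]
        by (intro has_nabla_deriv_diff pld_indefinite_integral_nabla_deriv[OF f])
          (auto simp: ld_continuous_at_def)
      then show ?thesis by simp
    qed
  qed (use that assms S' in auto)
  from this[OF \<open>u \<in> I\<close>] this[OF a_in] show ?thesis by simp
qed

lemma nabla_antiderivative_exists:
  assumes f: "pld f"
  shows "nabla_antiderivative I (\<lambda>u. integral {a..u} (\<lambda>s. f (up s))) f"
proof -
  obtain S where S: "finite S" "\<forall>t\<in>S. left_dense I t" "\<And>t. t \<in> kappa I - S \<Longrightarrow> ld_continuous_at I (kappa I) f t"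
    using f unfolding piecewise_ld_continuous_on_def by blast
  have "has_nabla_deriv I (\<lambda>u. integral {a..u} (\<lambda>s. f (up s))) t (f t)" if "t \<in> kappa I - S" for t
    using pld_indefinite_integral_nabla_deriv[OF f, of t 0] S(3)[OF that] that
    by (auto simp: ld_continuous_at_def)
  moreover have "continuous_on I (\<lambda>u. integral {a..u} (\<lambda>s. f (up s)))"
    by (rule continuous_on_subset[OF pld_indefinite_integral_continuous[OF f] I_subset])
  ultimately show ?thesis
    unfolding nabla_antiderivative_def using S by blast
qed

lemma nabla_integral_eq:
  assumes f: "pld f" and I: "I = ts_interval T a b"
  shows "nabla_integral T a b f = integral {a..b} (\<lambda>s. f (up s))"
  unfolding nabla_integral_def I[symmetric]
proof (rule the_equality)
  show "\<exists>F. nabla_antiderivative I F f \<and> integral {a..b} (\<lambda>s. f (up s)) = F b - F a"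
    using nabla_antiderivative_exists[OF f] by (intro exI conjI) auto
next
  fix J assume "\<exists>F. nabla_antiderivative I F f \<and> J = F b - F a"
  then obtain F S where "continuous_on I F" "finite S" "\<forall>t\<in>S. left_dense I t"
    "\<forall>t\<in>kappa I - S. has_nabla_deriv I F t (f t)" "J = F b - F a"
    unfolding nabla_antiderivative_def by blast
  with antiderivative_eq_integral[OF _ f, of F S b] b_in
  show "J = integral {a..b} (\<lambda>s. f (up s))" by auto
qed

end

section \<open>Piecewise ld-continuous integrands\<close>

context compact_time_scale
begin

lemma pld_map2:
  assumes \<phi>: "continuous_on UNIV (\<phi> :: real \<times> real \<Rightarrow> real)" and f: "pld f" and g: "pld g"
  shows "pld (\<lambda>t. \<phi> (f t, g t))"
proof -
  have lim: "((\<lambda>t. \<phi> (f t, g t)) \<longlongrightarrow> \<phi> (l, m)) F" if "(f \<longlongrightarrow> l) F" "(g \<longlongrightarrow> m) F" for l m F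
    by (rule continuous_on_tendsto_compose[OF \<phi> tendsto_Pair[OF that]]) auto
  obtain S where S: "finite S" "\<forall>t\<in>S. left_dense I t" "\<And>t. t \<in> kappa I - S \<Longrightarrow> ld_continuous_at I (kappa I) f t"
    using f unfolding piecewise_ld_continuous_on_def by blast
  obtain S' where S': "finite S'" "\<forall>t\<in>S'. left_dense I t" "\<And>t. t \<in> kappa I - S' \<Longrightarrow> ld_continuous_at I (kappa I) g t"
    using g unfolding piecewise_ld_continuous_on_def by blast
  have right: "\<exists>l. ((\<lambda>t. \<phi> (f t, g t)) \<longlongrightarrow> l) (at t within kappa I \<inter> {t<..})" if "t \<in> kappa I" "right_dense I t" for t
    using pldD_right[OF f that] pldD_right[OF g that] lim by blast
  show ?thesis
    unfolding piecewise_ld_continuous_on_def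
  proof (intro conjI ballI impI exI[of _ "S \<union> S'"])
    fix t assume t: "t \<in> kappa I" "left_dense I t"
    show "\<exists>l. ((\<lambda>t. \<phi> (f t, g t)) \<longlongrightarrow> l) (at t within kappa I \<inter> {..<t})"
      using pldD_left[OF f t] pldD_left[OF g t] lim by blast
  next
    fix t assume t: "t \<in> kappa I - (S \<union> S')"
    show "ld_continuous_at I (kappa I) (\<lambda>t. \<phi> (f t, g t)) t"
      using S(3)[of t] S'(3)[of t] t right[of t] lim
      by (auto simp: ld_continuous_at_def continuous_within)
  qed (use S S' right in auto)
qed

lemma pld_const: "pld (\<lambda>_. c)"
  by (rule ld_imp_pld) (auto simp: ld_continuous_on_def ld_continuous_at_def)

lemma pld_add: "pld f \<Longrightarrow> pld g \<Longrightarrow> pld (\<lambda>t. f t + g t)"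
  using pld_map2[of "\<lambda>z. fst z + snd z"] by (simp add: continuous_intros)

lemma pld_diff_abs: "pld f \<Longrightarrow> pld g \<Longrightarrow> pld (\<lambda>t. \<bar>f t - g t\<bar>)"
  using pld_map2[of "\<lambda>z. \<bar>fst z - snd z\<bar>"] by (simp add: continuous_intros)

lemma pld_mult: "pld f \<Longrightarrow> pld g \<Longrightarrow> pld (\<lambda>t. f t * g t)"
  using pld_map2[of "\<lambda>z. fst z * snd z"] by (simp add: continuous_intros)

text \<open>The strict comparison makes the step left-continuous, so its only discontinuity is a
  jump to the right of \<open>c\<close>. Exceptional points must be left-dense, hence the assumption
  on \<open>c\<close>.\<close>

lemma pld_step:
  assumes "left_dense I c"
  shows "pld (\<lambda>t. if c < t then 1 else 0 :: real)" (is "pld ?H")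
proof -
  have left: "(?H \<longlongrightarrow> ?H t) (at t within A \<inter> {..<t})" for t A
  proof (rule tendsto_eventually)
    have "\<forall>\<^sub>F s in at_left t. ?H s = ?H t"
      by (cases "c < t") (auto simp: eventually_at_left_field intro: lt_ex)
    then show "\<forall>\<^sub>F s in at t within A \<inter> {..<t}. ?H s = ?H t"
      by (rule filter_leD[rotated]) (auto intro: at_le)
  qed
  have right: "(?H \<longlongrightarrow> (if c \<le> t then 1 else 0)) (at t within A \<inter> {t<..})" for t A
  proof (rule tendsto_eventually)
    have "\<forall>\<^sub>F s in at_right t. ?H s = (if c \<le> t then 1 else 0)"
      by (cases "c \<le> t") (auto simp: eventually_at_right_field intro: gt_ex exI[of _ c])
    then show "\<forall>\<^sub>F s in at t within A \<inter> {t<..}. ?H s = (if c \<le> t then 1 else 0)"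
      by (rule filter_leD[rotated]) (auto intro: at_le)
  qed
  have cont: "isCont ?H t" if "t \<noteq> c" for t
  proof -
    have "filterlim ?H (nhds (?H t)) (at_left t)" "filterlim ?H (nhds (?H t)) (at_right t)"
      using left[of t UNIV] right[of t UNIV] that by (auto split: if_splits)
    then show ?thesis by (simp add: isCont_def filterlim_split_at)
  qed
  show ?thesis
    unfolding piecewise_ld_continuous_on_def
  proof (intro conjI ballI impI exI[of _ "{c}"])
    fix t assume "t \<in> kappa I - {c}"
    then have "t \<noteq> c" by blast
    then show "ld_continuous_at I (kappa I) ?H t"
      unfolding ld_continuous_at_def using cont right by (meson continuous_at_imp_continuous_at_within)
  qed (use left right assms in blast)+
qed

text \<open>Rounding up cannot cross a point \<open>c\<close> of \<open>I\<close>, so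
  \<open>c < up s\<close> and \<open>c < s\<close> agree.\<close>

lemma step_has_integral:
  assumes "c \<in> I" "a \<le> t" "t \<le> b"
  shows "((\<lambda>s. if c < up s then 1 else 0 :: real) has_integral max 0 (t - c)) {a..t}"
proof -
  have eq: "(if c < up s then 1 else 0 :: real) = (if c < s then 1 else 0)" if "s \<le> t" for s
    using ceil_ge[of s] ceil_le[OF assms(1), of s] that assms by force
  have "((\<lambda>s. if c < s then 1 else 0 :: real) has_integral max 0 (t - c)) {a..t}"
  proof (cases "c \<le> t")
    case True
    have "((\<lambda>s. if c < s then 1 else 0 :: real) has_integral 0) {a..c}"
      by (rule has_integral_is_0) auto
    moreover have "((\<lambda>s. 1 :: real) has_integral (t - c)) {c..t}"
      using has_integral_const_real[of "1::real" c t] True by simp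
    then have "((\<lambda>s. if c < s then 1 else 0 :: real) has_integral (t - c)) {c..t}"
      by (rule has_integral_spike_finite[of "{c}", rotated 2]) auto
    ultimately have "((\<lambda>s. if c < s then 1 else 0 :: real) has_integral (0 + (t - c))) {a..t}"
      using ge_a[OF assms(1)] True by (intro has_integral_combine)
    with True show ?thesis by simp
  next
    case False
    then have "((\<lambda>s. if c < s then 1 else 0 :: real) has_integral 0) {a..t}"
      by (intro has_integral_is_0) auto
    with False show ?thesis by simp
  qed
  then show ?thesis by (rule has_integral_eq[rotated]) (use eq in auto)
qed

text \<open>Comparison functions must be \<open>C\<^sup>1\<close>, so piecewise ld-continuous derivatives are multiplied by a
  cutoff that vanishes at the jumps.\<close>

lemma pld_approx_ld:
  assumes p: "pld p"
  obtains E R M where "finite E" "\<And>t. t \<in> E \<Longrightarrow> left_dense I t"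
    "\<And>n :: nat. ld_continuous_on I (kappa I) (R n)"
    "\<And>n t. t \<in> kappa I \<Longrightarrow> \<bar>R n t\<bar> \<le> M"
    "\<And>t. t \<in> kappa I - E \<Longrightarrow> (\<lambda>n. R n t) \<longlonglongrightarrow> p t"
proof -
  obtain S where S: "finite S" "\<forall>t\<in>S. left_dense I t" "\<And>t. t \<in> kappa I - S \<Longrightarrow> ld_continuous_at I (kappa I) p t"
    using p unfolding piecewise_ld_continuous_on_def by blast
  obtain M where "\<And>s. s \<in> {a..b} \<Longrightarrow> \<bar>p (up s)\<bar> \<le> M" using pld_bounded[OF p] by blast
  then have M: "\<bar>p t\<bar> \<le> M" if "t \<in> kappa I" for t
    using that kappa_subset ceil_id[of t] I_subset by force
  define E where "E = insert a S"
  define ch where "ch n t = min 1 (real n * infdist t E)" for n :: nat and t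
  have ch01: "0 \<le> ch n t" "ch n t \<le> 1" for n t by (auto simp: ch_def infdist_nonneg)
  have ch_cont: "(ch n \<longlongrightarrow> ch n t) (at t within A)" for n t A
    unfolding ch_def by (intro tendsto_intros)
  show ?thesis
  proof (rule that[of E "\<lambda>n t. p t * ch n t" M])
    show "finite E" "\<And>t. t \<in> E \<Longrightarrow> left_dense I t"
      using S left_dense_a by (auto simp: E_def)
    show "\<bar>p t * ch n t\<bar> \<le> M" if "t \<in> kappa I" for n t
    proof -
      have "\<bar>p t * ch n t\<bar> \<le> \<bar>p t\<bar> * 1"
        unfolding abs_mult using ch01[of n t] by (intro mult_left_mono) auto
      with M[OF that] show ?thesis by simp
    qed
    show "(\<lambda>n. p t * ch n t) \<longlonglongrightarrow> p t" if "t \<in> kappa I - E" for t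
    proof -
      have "infdist t E > 0"
        using that \<open>finite E\<close> infdist_nonneg[of t E]
        by (metis DiffD2 E_def finite_imp_closed in_closed_iff_infdist_zero insert_not_empty order_le_less)
      then have "\<forall>\<^sub>F n in sequentially. real n * infdist t E \<ge> 1"
        by real_asymp
      then have "\<forall>\<^sub>F n in sequentially. p t * ch n t = p t"
        by eventually_elim (simp add: ch_def)
      then show ?thesis by (rule tendsto_eventually)
    qed
    show "ld_continuous_on I (kappa I) (\<lambda>t. p t * ch n t)" for n
      unfolding ld_continuous_on_def ld_continuous_at_def
    proof (intro ballI conjI impI)
      fix t assume t: "t \<in> kappa I"
      show "\<exists>l. ((\<lambda>t. p t * ch n t) \<longlongrightarrow> l) (at t within kappa I \<inter> {t<..})" if "right_dense I t"
        using pldD_right[OF p t that] ch_cont tendsto_mult by blast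
      assume ld: "left_dense I t"
      show "continuous (at t within kappa I) (\<lambda>t. p t * ch n t)"
      proof (cases "t \<in> S")
        case False
        then have "(p \<longlongrightarrow> p t) (at t within kappa I)"
          using S(3)[of t] t ld by (simp add: ld_continuous_at_def continuous_within)
        from tendsto_mult[OF this ch_cont] show ?thesis by (simp add: continuous_within)
      next
        case True
        then have ch0: "ch n t = 0" by (simp add: ch_def E_def)
        \<comment> \<open>At a jump \<open>p\<close> need not be continuous, but it is bounded by
          \<open>M\<close>, and the cutoff squeezes the product to zero.\<close>
        have "((\<lambda>s. M * ch n s) \<longlongrightarrow> M * 0) (at t within kappa I)"
          using ch_cont[of n t "kappa I"] ch0 by (intro tendsto_intros) simp
        then have "((\<lambda>s. M * ch n s) \<longlongrightarrow> 0) (at t within kappa I)" by simp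
        moreover have "\<forall>\<^sub>F s in at t within kappa I. norm (p s * ch n s) \<le> M * ch n s"
          unfolding eventually_at_filter
          using M ch01 by (auto simp: abs_mult intro!: always_eventually mult_right_mono)
        ultimately have "((\<lambda>s. p s * ch n s) \<longlongrightarrow> 0) (at t within kappa I)"
          by (rule Lim_null_comparison[rotated])
        with ch0 show ?thesis by (simp add: continuous_within)
      qed
    qed
  qed
qed

text \<open>A point \<open>u\<close> of \<open>I\<close> between \<open>c\<close> and
  \<open>t\<close> is a barrier: for \<open>s > u\<close> in \<open>I\<close> the backward jump
  cannot fall below \<open>u\<close>.\<close>

lemma rho_tendsto_left:
  assumes "t \<in> I" "a < t" "left_dense I t"
  shows "(rh \<longlongrightarrow> t) (at t within kappa I \<inter> {..<t})"
proof (rule order_tendstoI)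
  fix c assume "c < t"
  then obtain u where u: "u \<in> I" "c < u" "u < t" using left_denseD[OF assms] by blast
  have "\<forall>\<^sub>F s in at_left t. u < s" using u by (auto simp: eventually_at_left_field)
  then have "\<forall>\<^sub>F s in at t within kappa I \<inter> {..<t}. u < s"
    by (rule filter_leD[rotated]) (auto intro: at_le)
  moreover have "\<forall>\<^sub>F s in at t within kappa I \<inter> {..<t}. s \<in> I"
    using kappa_subset by (auto simp: eventually_at_filter intro!: always_eventually)
  ultimately show "\<forall>\<^sub>F s in at t within kappa I \<inter> {..<t}. c < rh s"
    by eventually_elim (use le_rho[OF u(1)] u in force)
next
  fix c assume "t < c"
  then show "\<forall>\<^sub>F s in at t within kappa I \<inter> {..<t}. rh s < c"
    unfolding eventually_at_filter
    by (auto intro!: always_eventually) (meson rho_le kappa_subset order_le_less_trans less_trans subsetD)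
qed

lemma rho_tendsto_right:
  assumes "t \<in> I"
  shows "(rh \<longlongrightarrow> t) (at t within kappa I \<inter> {t<..})"
proof (rule tendsto_sandwich[of "\<lambda>_. t" _ _ "\<lambda>s. s"])
  show "\<forall>\<^sub>F s in at t within kappa I \<inter> {t<..}. t \<le> rh s" "\<forall>\<^sub>F s in at t within kappa I \<inter> {t<..}. rh s \<le> s"
    using kappa_subset le_rho[OF assms] rho_le
    by (auto simp: eventually_at_filter intro!: always_eventually)
qed auto

lemma tendsto_kappa_split:
  assumes "(f \<longlongrightarrow> l) (at t within kappa I \<inter> {..<t})" "(f \<longlongrightarrow> l) (at t within kappa I \<inter> {t<..})"
  shows "(f \<longlongrightarrow> l) (at t within kappa I)"
proof -
  have "(f \<longlongrightarrow> l) (at t within (kappa I \<inter> {..<t}) \<union> (kappa I \<inter> {t<..}))"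
    using assms by (rule Lim_Un)
  moreover have "(kappa I \<inter> {..<t}) \<union> (kappa I \<inter> {t<..}) = kappa I - {t}" by auto
  ultimately show ?thesis by (simp add: at_within_def)
qed

end

section \<open>Lagrangians along piecewise smooth functions\<close>

lemma bounded_image_locally:
  assumes "compact C" and "\<And>z. z \<in> C \<Longrightarrow> \<exists>U. open U \<and> z \<in> U \<and> bounded (f ` (U \<inter> C))"
  shows "bounded (f ` C)"
proof -
  have "\<forall>z\<in>C. \<exists>U. open U \<and> z \<in> U \<and> bounded (f ` (U \<inter> C))" using assms(2) by blast
  from bchoice[OF this] obtain U where U: "\<forall>z\<in>C. open (U z) \<and> z \<in> U z \<and> bounded (f ` (U z \<inter> C))" ..
  obtain D where D: "D \<subseteq> C" "finite D" "C \<subseteq> (\<Union>z\<in>D. U z)"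
    by (rule compactE_image[OF assms(1), of C U]) (use U in auto)
  have "bounded (\<Union>z\<in>D. f ` (U z \<inter> C))"
    using D U by (intro bounded_UN) auto
  then show ?thesis by (rule bounded_subset) (use D in fastforce)
qed

text \<open>The regularity of \<open>L\<close> refers to the ambient \<open>T\<close>, whereas
  derivatives, jumps and integrals live on \<open>I\<close>; both time scales are therefore
  kept.\<close>

locale lagrangian = compact_time_scale I a b for I :: "real set" and a b :: real +
  fixes T :: "real set" and L :: "real \<Rightarrow> real \<Rightarrow> real \<Rightarrow> real"
  assumes I_eq: "I = ts_interval T a b"
    and C2: "\<And>t. t \<in> T \<Longrightarrow> C2_fun (\<lambda>(x, r). L t x r)" and ld: "ld_continuous_first T L"
begin

lemma I_T: "t \<in> I \<longleftrightarrow> t \<in> T \<and> a \<le> t \<and> t \<le> b"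
  by (simp add: I_eq ts_interval_def)

text \<open>The maximum \<open>b\<close> is right-dense in \<open>I\<close> by convention, whatever
  \<open>T\<close> looks like above it, hence \<open>t < b\<close>. The left-sided companion
  excludes \<open>a\<close> for the same reason.\<close>

lemma right_dense_T:
  assumes "t \<in> I" "t < b" "right_dense I t" shows "right_dense T t"
proof -
  have ne: "{s \<in> T. t < s} \<noteq> {}" using b_in assms I_T by blast
  have "Inf {s \<in> T. t < s} = t"
  proof (rule cInf_eq_non_empty[OF ne])
    fix y assume y: "\<And>x. x \<in> {s \<in> T. t < s} \<Longrightarrow> y \<le> x"
    show "y \<le> t"
    proof (rule ccontr)
      assume "\<not> y \<le> t"
      with right_denseD[OF assms, of y] y I_T show False by force
    qed
  qed auto
  with ne show ?thesis by (simp only: right_dense_def ts_sigma_def if_False)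
qed

lemma left_dense_T:
  assumes "t \<in> I" "a < t" "left_dense I t" shows "left_dense T t"
proof -
  have ne: "{s \<in> T. s < t} \<noteq> {}" using a_in assms I_T by blast
  have "Sup {s \<in> T. s < t} = t"
  proof (rule cSup_eq_non_empty[OF ne])
    fix y assume y: "\<And>x. x \<in> {s \<in> T. s < t} \<Longrightarrow> x \<le> y"
    show "t \<le> y"
    proof (rule ccontr)
      assume "\<not> t \<le> y"
      with left_denseD[OF assms, of y] y I_T show False by force
    qed
  qed auto
  with ne show ?thesis by (simp only: left_dense_def ts_rho_def if_False)
qed

lemma L_continuous: "t \<in> T \<Longrightarrow> continuous_on UNIV (\<lambda>(x, r). L t x r)"
  using C2 unfolding C2_fun_def
  by (metis continuous_at_imp_continuous_on has_derivative_continuous)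

lemma tendsto_L_fixed:
  assumes "t \<in> T" "(y \<longlongrightarrow> x) F" "(p \<longlongrightarrow> r) F"
  shows "((\<lambda>s. L t (y s) (p s)) \<longlongrightarrow> L t x r) F"
  using continuous_on_tendsto_compose[OF L_continuous[OF assms(1)] tendsto_Pair[OF assms(2,3)]] by simp

lemma tendsto_L_left_dense:
  assumes "t \<in> T" "left_dense T t" "\<forall>\<^sub>F s in F. u s \<in> T"
    and "(u \<longlongrightarrow> t) F" "(y \<longlongrightarrow> x) F" "(p \<longlongrightarrow> r) F"
  shows "((\<lambda>s. L (u s) (y s) (p s)) \<longlongrightarrow> L t x r) F"
proof -
  have "continuous (at (t, x, r) within T \<times> UNIV) (\<lambda>(s, y, p). L s y p)"
    using ld assms by (simp add: ld_continuous_first_def)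
  moreover have "\<forall>\<^sub>F s in F. (u s, y s, p s) \<in> T \<times> UNIV" using assms(3) by eventually_elim simp
  moreover have "((\<lambda>s. (u s, y s, p s)) \<longlongrightarrow> (t, x, r)) F" by (intro tendsto_Pair assms)
  ultimately show ?thesis
    using continuous_within_tendsto_compose[of "(t,x,r)" "T \<times> UNIV" "\<lambda>(s, y, p). L s y p" "\<lambda>s. (u s, y s, p s)" F]
    by simp
qed

lemma tendsto_L_right_dense:
  assumes "t \<in> T" "right_dense T t" "\<forall>\<^sub>F s in F. u s \<in> T \<and> t < u s"
    and "(u \<longlongrightarrow> t) F" "(y \<longlongrightarrow> x) F" "(p \<longlongrightarrow> r) F"
  shows "\<exists>l. ((\<lambda>s. L (u s) (y s) (p s)) \<longlongrightarrow> l) F"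
proof -
  obtain l where l: "((\<lambda>(s, y, p). L s y p) \<longlongrightarrow> l) (at (t, x, r) within (T \<inter> {t<..}) \<times> UNIV)"
    using ld assms unfolding ld_continuous_first_def by blast
  have "filterlim (\<lambda>s. (u s, y s, p s)) (at (t, x, r) within (T \<inter> {t<..}) \<times> UNIV) F"
    unfolding filterlim_at
  proof
    show "\<forall>\<^sub>F s in F. (u s, y s, p s) \<in> (T \<inter> {t<..}) \<times> UNIV \<and> (u s, y s, p s) \<noteq> (t, x, r)"
      using assms(3) by eventually_elim auto
    show "((\<lambda>s. (u s, y s, p s)) \<longlongrightarrow> (t, x, r)) F" by (intro tendsto_Pair assms)
  qed
  from filterlim_compose[OF l this] show ?thesis by auto
qed

lemma integrand_pld:
  assumes h: "continuous_on I h" and p: "pld p"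
  shows "pld (\<lambda>t. L t (h (rh t)) (p t))"
proof -
  obtain S where S: "finite S" "\<forall>t\<in>S. left_dense I t" "\<And>t. t \<in> kappa I - S \<Longrightarrow> ld_continuous_at I (kappa I) p t"
    using p unfolding piecewise_ld_continuous_on_def by blast
  have kT: "t \<in> I \<and> t \<in> T" if "t \<in> kappa I" for t using that kappa_subset I_T by blast
  have ev: "\<forall>\<^sub>F s in at t within kappa I \<inter> A. s \<in> T" "\<forall>\<^sub>F s in at t within kappa I \<inter> A. rh s \<in> I" for t A
    using kT rho_mem by (auto simp: eventually_at_filter intro!: always_eventually)
  have hl: "((\<lambda>s. h (rh s)) \<longlongrightarrow> h t) (at t within kappa I \<inter> {..<t})" if "t \<in> I" "a < t" "left_dense I t" for t
    using continuous_on_tendsto_compose[OF h rho_tendsto_left[OF that]] that ev by blast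
  have hr: "((\<lambda>s. h (rh s)) \<longlongrightarrow> h t) (at t within kappa I \<inter> {t<..})" if "t \<in> I" for t
    using continuous_on_tendsto_compose[OF h rho_tendsto_right[OF that]] that ev by blast
  have right: "\<exists>l. ((\<lambda>t. L t (h (rh t)) (p t)) \<longlongrightarrow> l) (at t within kappa I \<inter> {t<..})"
    if t: "t \<in> kappa I" and rd: "right_dense I t" for t
  proof (cases "t < b")
    case True
    obtain l where l: "(p \<longlongrightarrow> l) (at t within kappa I \<inter> {t<..})" using pldD_right[OF p t rd] by blast
    have ev': "\<forall>\<^sub>F s in at t within kappa I \<inter> {t<..}. s \<in> T \<and> t < s"
      using kT by (auto simp: eventually_at_filter)
    show ?thesis
      using right_dense_T[OF _ True rd] kT[OF t] hr
      by (intro tendsto_L_right_dense[OF _ _ ev' _ _ l]) auto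
  next
    case False
    then have "kappa I \<inter> {t<..} = {}" using kT le_b by force
    then show ?thesis by simp
  qed
  show ?thesis
    unfolding piecewise_ld_continuous_on_def
  \<comment> \<open>\<open>a\<close> joins the exceptional set: it counts as left-dense in
    \<open>I\<close>, but if it is left-scattered in \<open>T\<close>, only a right-sided limit of
    \<open>L\<close> is available there.\<close>
  proof (intro conjI ballI impI exI[of _ "insert a S"])
    fix t assume t: "t \<in> kappa I" "left_dense I t"
    show "\<exists>l. ((\<lambda>t. L t (h (rh t)) (p t)) \<longlongrightarrow> l) (at t within kappa I \<inter> {..<t})"
    proof (cases "a < t")
      case True
      obtain l where "(p \<longlongrightarrow> l) (at t within kappa I \<inter> {..<t})" using pldD_left[OF p t] by blast
      then have "((\<lambda>t. L t (h (rh t)) (p t)) \<longlongrightarrow> L t (h t) l) (at t within kappa I \<inter> {..<t})"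
        using True t kT hl left_dense_T ev by (intro tendsto_L_left_dense) auto
      then show ?thesis by blast
    next
      case False
      then have "kappa I \<inter> {..<t} = {}" using kT ge_a by force
      then show ?thesis by simp
    qed
  next
    fix t assume t: "t \<in> kappa I - insert a S"
    then have at: "a < t" "t \<in> I" using kT ge_a by (auto simp: order_le_less)
    have "continuous (at t within kappa I) (\<lambda>t. L t (h (rh t)) (p t))" if ld: "left_dense I t"
    proof -
      have "(p \<longlongrightarrow> p t) (at t within kappa I)"
        using S(3)[of t] t ld by (simp add: ld_continuous_at_def continuous_within)
      moreover have "((\<lambda>s. h (rh s)) \<longlongrightarrow> h t) (at t within kappa I)"
        using tendsto_kappa_split hl hr at ld by blast
      ultimately have "((\<lambda>t. L t (h (rh t)) (p t)) \<longlongrightarrow> L t (h t) (p t)) (at t within kappa I)"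
        using at ld left_dense_T ev[where A = UNIV] kT t by (intro tendsto_L_left_dense) auto
      with ld show ?thesis by (simp add: continuous_within left_dense_def)
    qed
    with right t show "ld_continuous_at I (kappa I) (\<lambda>t. L t (h (rh t)) (p t)) t"
      by (simp add: ld_continuous_at_def)
  next
    show "finite (insert a S)" using S by simp
    show "left_dense I t" if "t \<in> insert a S" for t using that S left_dense_a by auto
  qed (rule right)
qed

lemma functional_eq:
  assumes "continuous_on I h" "pld (nabla_deriv I h)"
  shows "functional L T a b h = integral {a..b} (\<lambda>s. L (up s) (h (rh (up s))) (nabla_deriv I h (up s)))"
  unfolding functional_def I_eq[symmetric]
  using nabla_integral_eq[OF integrand_pld[OF assms] I_eq] .

text \<open>\<open>L\<close> may jump in \<open>t\<close>, so continuity on a compact set cannot be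
  invoked. Around each point \<open>L\<close> is still bounded, because the limits over
  \<open>s < t\<close>, \<open>s = t\<close> and \<open>s > t\<close> exist separately, and
  compactness makes the bound uniform. It is the dominating constant when the functional is passed
  to the limit.\<close>

lemma L_bounded:
  "\<exists>M. \<forall>t\<in>I. \<forall>x r. \<bar>x\<bar> \<le> K \<longrightarrow> \<bar>r\<bar> \<le> K \<longrightarrow> \<bar>L t x r\<bar> \<le> M"
proof -
  let ?f = "\<lambda>(s, y, p). L s y p"
  define C where "C = I \<times> {-K..K} \<times> {-K..K}"
  have "compact I" using closed_I I_subset by (meson bounded_closed_interval bounded_subset compact_eq_bounded_closed)
  then have "compact C" unfolding C_def by (intro compact_Times) auto
  have "\<exists>U. open U \<and> z \<in> U \<and> bounded (?f ` (U \<inter> C))" if zC: "z \<in> C" for z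
  proof -
    obtain t x r where z: "z = (t, x, r)" by (cases z)
    with zC have tI: "t \<in> I" and tT: "t \<in> T" by (auto simp: C_def I_T)
    have bnd: "\<exists>M. \<forall>\<^sub>F w in F. \<bar>?f w\<bar> \<le> M" if "(?f \<longlongrightarrow> l) F" for l F
    proof -
      have "\<forall>\<^sub>F w in F. dist (?f w) l < 1" using that by (rule tendstoD) simp
      then have "\<forall>\<^sub>F w in F. \<bar>?f w\<bar> \<le> \<bar>l\<bar> + 1"
        by eventually_elim (simp add: dist_real_def)
      then show ?thesis by blast
    qed
    have l: "\<exists>l. (?f \<longlongrightarrow> l) (at z within (I \<inter> {..<t}) \<times> UNIV)"
    proof (cases "a < t \<and> left_dense I t")
      case True
      then have "(?f \<longlongrightarrow> ?f z) (at z within T \<times> UNIV)"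
        using ld tT left_dense_T[OF tI] unfolding ld_continuous_first_def z by (simp add: continuous_within)
      then have "(?f \<longlongrightarrow> ?f z) (at z within (I \<inter> {..<t}) \<times> UNIV)"
        by (rule tendsto_within_subset) (auto simp: I_T)
      then show ?thesis by blast
    next
      case False
      from left_gap[OF tI False] obtain c where c: "c < t" "\<And>s. s \<in> I \<Longrightarrow> s < t \<Longrightarrow> s \<le> c" by blast
      have "at z within (I \<inter> {..<t}) \<times> UNIV = bot"
        unfolding trivial_limit_def eventually_at_topological
        by (rule exI[of _ "{c<..} \<times> UNIV"]) (use c in \<open>force simp: z intro!: open_Times\<close>)
      then show ?thesis by simp
    qed
    have m: "\<exists>l. (?f \<longlongrightarrow> l) (at z within {t} \<times> UNIV)"
    proof -
      have "((\<lambda>w. L t (fst (snd w)) (snd (snd w))) \<longlongrightarrow> L t (fst (snd z)) (snd (snd z))) (at z within {t} \<times> UNIV)"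
        by (intro tendsto_L_fixed[OF tT] tendsto_intros)
      then have "(?f \<longlongrightarrow> L t (fst (snd z)) (snd (snd z))) (at z within {t} \<times> UNIV)"
        by (rule Lim_transform_eventually) (auto simp: eventually_at_filter intro!: always_eventually)
      then show ?thesis by blast
    qed
    have r: "\<exists>l. (?f \<longlongrightarrow> l) (at z within (I \<inter> {t<..}) \<times> UNIV)"
    proof (cases "t < b \<and> right_dense I t")
      case True
      then obtain l where "(?f \<longlongrightarrow> l) (at z within (T \<inter> {t<..}) \<times> UNIV)"
        using ld tT right_dense_T[OF tI] unfolding ld_continuous_first_def z by blast
      then have "(?f \<longlongrightarrow> l) (at z within (I \<inter> {t<..}) \<times> UNIV)"
        by (rule tendsto_within_subset) (auto simp: I_T)
      then show ?thesis by blast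
    next
      case False
      from right_gap[OF tI False] obtain c where c: "c > t" "\<And>s. s \<in> I \<Longrightarrow> t < s \<Longrightarrow> c \<le> s" by blast
      have "at z within (I \<inter> {t<..}) \<times> UNIV = bot"
        unfolding trivial_limit_def eventually_at_topological
        by (rule exI[of _ "{..<c} \<times> UNIV"]) (use c in \<open>force simp: z intro!: open_Times\<close>)
      then show ?thesis by simp
    qed
    obtain M1 M2 M3 where M: "\<forall>\<^sub>F w in at z within (I \<inter> {..<t}) \<times> UNIV. \<bar>?f w\<bar> \<le> M1"
      "\<forall>\<^sub>F w in at z within {t} \<times> UNIV. \<bar>?f w\<bar> \<le> M2"
      "\<forall>\<^sub>F w in at z within (I \<inter> {t<..}) \<times> UNIV. \<bar>?f w\<bar> \<le> M3"
      using l m r bnd by meson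
    define M where "M = max (max M1 M2) (max M3 \<bar>?f z\<bar>)"
    have "\<forall>\<^sub>F w in nhds z. w \<in> C \<longrightarrow> \<bar>?f w\<bar> \<le> M"
      using M unfolding eventually_at_filter
    proof eventually_elim
      case (elim w)
      show ?case
      proof
        assume "w \<in> C"
        then have w: "fst w \<in> I" by (auto simp: C_def)
        consider "w = z" | "w \<noteq> z" "fst w < t" | "w \<noteq> z" "fst w = t" | "w \<noteq> z" "t < fst w"
          by linarith
        then show "\<bar>?f w\<bar> \<le> M"
        proof cases
          case 1 then show ?thesis by (simp add: M_def)
        next
          case 2
          then have "\<bar>?f w\<bar> \<le> M1" using elim(1) w by (cases w) auto
          then show ?thesis by (simp add: M_def)
        next
          case 3
          then have "\<bar>?f w\<bar> \<le> M2" using elim(2) w by (cases w) auto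
          then show ?thesis by (simp add: M_def)
        next
          case 4
          then have "\<bar>?f w\<bar> \<le> M3" using elim(3) w by (cases w) auto
          then show ?thesis by (simp add: M_def)
        qed
      qed
    qed
    then obtain U where U: "open U" "z \<in> U" "\<And>w. w \<in> U \<Longrightarrow> w \<in> C \<Longrightarrow> \<bar>?f w\<bar> \<le> M"
      unfolding eventually_nhds by blast
    then have "bounded (?f ` (U \<inter> C))" by (intro boundedI[of _ M]) auto
    with U show ?thesis by blast
  qed
  from bounded_image_locally[OF \<open>compact C\<close> this] obtain M where M: "\<forall>y\<in>?f ` C. \<bar>y\<bar> \<le> M"
    unfolding bounded_iff real_norm_def by blast
  have "\<bar>L t x r\<bar> \<le> M" if "t \<in> I" "\<bar>x\<bar> \<le> K" "\<bar>r\<bar> \<le> K" for t x r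
  proof -
    have "(t, x, r) \<in> C" using that by (auto simp: C_def abs_le_iff)
    then have "?f (t, x, r) \<in> ?f ` C" by (rule imageI)
    with M show ?thesis by auto
  qed
  then show ?thesis by blast
qed

end

section \<open>The two-slope variation\<close>

lemma bounded_convergence_finite:
  fixes f :: "nat \<Rightarrow> real \<Rightarrow> real"
  assumes f: "\<And>k. f k integrable_on {a..b}" and "finite E"
    and le: "\<And>k x. x \<in> {a..b} - E \<Longrightarrow> \<bar>f k x\<bar> \<le> C"
    and conv: "\<And>x. x \<in> {a..b} - E \<Longrightarrow> (\<lambda>k. f k x) \<longlonglongrightarrow> g x"
  shows "(\<lambda>k. integral {a..b} (f k)) \<longlonglongrightarrow> integral {a..b} g"
proof -
  define f' where "f' k x = (if x \<in> E then 0 else f k x)" for k x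
  define g' where "g' x = (if x \<in> E then 0 else g x)" for x
  have neg: "negligible E" using \<open>finite E\<close> by (rule negligible_finite)
  have "(\<lambda>k. integral {a..b} (f' k)) \<longlonglongrightarrow> integral {a..b} g'"
  proof (rule dominated_convergence[of _ _ "\<lambda>_. \<bar>C\<bar>"])
    show "f' k integrable_on {a..b}" for k
      by (rule integrable_spike_finite[OF \<open>finite E\<close> _ f[of k]]) (auto simp: f'_def)
    show "norm (f' k x) \<le> \<bar>C\<bar>" if "x \<in> {a..b}" for k x
      using le[of x k] that by (auto simp: f'_def)
    show "(\<lambda>k. f' k x) \<longlonglongrightarrow> g' x" if "x \<in> {a..b}" for x
      using conv[of x] that by (auto simp: f'_def g'_def)
  qed auto
  moreover have "integral {a..b} (f' k) = integral {a..b} (f k)" for k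
    by (rule integral_spike[OF neg]) (auto simp: f'_def)
  moreover have "integral {a..b} g' = integral {a..b} g"
    by (rule integral_spike[OF neg]) (auto simp: g'_def)
  ultimately show ?thesis by simp
qed

lemma ld_continuous_on_cong:
  assumes "\<And>t. t \<in> D \<Longrightarrow> f t = g t" "ld_continuous_on X D f"
  shows "ld_continuous_on X D g"
proof -
  have lim: "(g \<longlongrightarrow> l) (at t within D \<inter> A)" if "(f \<longlongrightarrow> l) (at t within D \<inter> A)" for l t A
    by (rule Lim_transform_eventually[OF that])
      (auto simp: eventually_at_filter assms(1) intro!: always_eventually)
  show ?thesis
    using assms lim lim[where A = UNIV]
    unfolding ld_continuous_on_def ld_continuous_at_def continuous_within by (metis Int_UNIV_right)
qed

context compact_time_scale
begin

lemma pld_integrable_sub: "pld f \<Longrightarrow> t \<le> b \<Longrightarrow> (\<lambda>s. f (up s)) integrable_on {a..t}"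
  by (rule integrable_on_subinterval[OF pld_integrable]) auto

text \<open>Source of admissible functions: an ld-continuous derivative is prescribed and
  integrated.\<close>

lemma C1_ld_indefinite_integral:
  assumes q: "ld_continuous_on I (kappa I) q"
  shows "C1_ld I (\<lambda>t. C + integral {a..t} (\<lambda>s. q (up s)))" (is "C1_ld I ?y")
    and "\<And>t. t \<in> kappa I \<Longrightarrow> nabla_deriv I (\<lambda>t. C + integral {a..t} (\<lambda>s. q (up s))) t = q t"
proof -
  have *: "has_nabla_deriv I ?y t (q t)" if "t \<in> kappa I" for t
    using q that by (intro pld_indefinite_integral_nabla_deriv ld_imp_pld)
      (auto simp: ld_continuous_on_def ld_continuous_at_def)
  show eq: "nabla_deriv I ?y t = q t" if "t \<in> kappa I" for t
    using nabla_deriv_eq[OF *[OF that]] .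
  have "ld_continuous_on I (kappa I) (nabla_deriv I ?y)"
    using ld_continuous_on_cong[OF eq[symmetric] q] .
  with * show "C1_ld I ?y" by (auto simp: C1_ld_def nabla_differentiable_def)
qed

text \<open>Mean closeness of derivatives forces uniform closeness of primitives, the only closeness
  that a strong minimum asks for.\<close>

lemma integral_ceil_diff_le:
  assumes f: "pld f" and g: "pld g" and t: "t \<in> {a..b}"
  shows "\<bar>integral {a..t} (\<lambda>s. f (up s)) - integral {a..t} (\<lambda>s. g (up s))\<bar>
    \<le> integral {a..b} (\<lambda>s. \<bar>f (up s) - g (up s)\<bar>)"
proof -
  have i: "(\<lambda>s. f (up s)) integrable_on {a..t}" "(\<lambda>s. g (up s)) integrable_on {a..t}"
    "(\<lambda>s. \<bar>f (up s) - g (up s)\<bar>) integrable_on {a..t}" "(\<lambda>s. \<bar>f (up s) - g (up s)\<bar>) integrable_on {a..b}"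
    using pld_integrable_sub[OF f] pld_integrable_sub[OF g] pld_integrable_sub[OF pld_diff_abs[OF f g]] t by auto
  have "integral {a..t} (\<lambda>s. f (up s)) - integral {a..t} (\<lambda>s. g (up s)) = integral {a..t} (\<lambda>s. f (up s) - g (up s))"
    using i by (simp add: Henstock_Kurzweil_Integration.integral_diff)
  also have "\<bar>\<dots>\<bar> \<le> integral {a..t} (\<lambda>s. \<bar>f (up s) - g (up s)\<bar>)"
    using i integral_norm_bound_integral[of "\<lambda>s. f (up s) - g (up s)" "{a..t}" "\<lambda>s. \<bar>f (up s) - g (up s)\<bar>"]
    by (simp add: integrable_diff)
  also have "\<dots> \<le> integral {a..b} (\<lambda>s. \<bar>f (up s) - g (up s)\<bar>)"
    using i t by (intro integral_subset_le) auto
  finally show ?thesis .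
qed

lemma interval_rho:
  assumes "{u..v} \<subseteq> I" "u < s" "s \<le> v"
  shows "rh s = s"
proof (rule antisym)
  have sI: "s \<in> I" using assms by auto
  show "rh s \<le> s" using rho_le sI by blast
  show "s \<le> rh s"
  proof (rule dense_le_bounded[OF assms(2)])
    fix c assume "u < c" "c < s"
    then show "c \<le> rh s" using assms sI by (intro le_rho) auto
  qed
qed

end

section \<open>From admissible competitors to competitors with corners\<close>

context lagrangian
begin

text \<open>Extends the minimum property to functions whose derivative \<open>p\<close> jumps.
  Cutoffs of \<open>p\<close>, corrected by a constant slope that restores the boundary value, yield
  admissible \<open>z n\<close> converging uniformly to \<open>y\<close>, and the functional follows
  by dominated convergence. The margin \<open>\<delta> / 2\<close> leaves room for the approximation
  error.\<close>

lemma comparison: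
  assumes p: "pld p" and tot: "A + integral {a..b} (\<lambda>s. p (up s)) = B" and "\<delta> > 0"
    and y: "\<And>t. t \<in> I \<Longrightarrow> y t = A + integral {a..t} (\<lambda>s. p (up s))"
    and near: "\<And>t. t \<in> I \<Longrightarrow> \<bar>y t - xb t\<bar> \<le> \<delta> / 2"
    and min: "\<And>z. C1_ld I z \<Longrightarrow> z a = A \<Longrightarrow> z b = B \<Longrightarrow> (\<And>t. t \<in> I \<Longrightarrow> \<bar>z t - xb t\<bar> \<le> \<delta>)
      \<Longrightarrow> J \<le> functional L T a b z"
  shows "J \<le> integral {a..b} (\<lambda>s. L (up s) (y (rh (up s))) (p (up s)))"
proof -
  obtain E R M where E: "finite E" "\<And>t. t \<in> E \<Longrightarrow> left_dense I t"
    and R: "\<And>n :: nat. ld_continuous_on I (kappa I) (R n)"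
    and M: "\<And>n t. t \<in> kappa I \<Longrightarrow> \<bar>R n t\<bar> \<le> M"
    and Rp: "\<And>t. t \<in> kappa I - E \<Longrightarrow> (\<lambda>n. R n t) \<longlonglongrightarrow> p t"
    using pld_approx_ld[OF p] by metis
  have Rpld: "pld (R n)" for n by (rule ld_imp_pld[OF R])
  \<comment> \<open>\<open>a\<close> is discarded because \<open>up a = a\<close> may lie outside
    \<open>kappa I\<close>, where \<open>R n\<close> is not controlled.\<close>
  define E' where "E' = insert a E"
  have E'fin: "finite E'" using E by (simp add: E'_def)
  have upE: "up s \<in> kappa I" "up s \<notin> E" if "s \<in> {a..b} - E'" for s
    using that ceil_kappa[of s] ceil_left_dense[of s] E(2) by (auto simp: E'_def)
  obtain N where N: "\<And>s. s \<in> {a..b} \<Longrightarrow> \<bar>p (up s)\<bar> \<le> N" using pld_bounded[OF p] by blast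
  define D where "D n = integral {a..b} (\<lambda>s. \<bar>R n (up s) - p (up s)\<bar>)" for n
  have "D \<longlonglongrightarrow> integral {a..b} (\<lambda>s. \<bar>p (up s) - p (up s)\<bar>)"
    unfolding D_def
  proof (rule bounded_convergence_finite[OF _ E'fin])
    show "(\<lambda>s. \<bar>R n (up s) - p (up s)\<bar>) integrable_on {a..b}" for n
      by (rule pld_integrable[OF pld_diff_abs[OF Rpld p]])
    show "\<bar>\<bar>R n (up s) - p (up s)\<bar>\<bar> \<le> M + N" if "s \<in> {a..b} - E'" for n s
    proof -
      have "\<bar>R n (up s)\<bar> \<le> M" "\<bar>p (up s)\<bar> \<le> N" using M N upE(1)[OF that] that by auto
      then show ?thesis by linarith
    qed
    show "(\<lambda>n. \<bar>R n (up s) - p (up s)\<bar>) \<longlonglongrightarrow> \<bar>p (up s) - p (up s)\<bar>" if "s \<in> {a..b} - E'" for s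
      using Rp[of "up s"] upE[OF that] by (intro tendsto_intros) auto
  qed
  then have D0: "D \<longlonglongrightarrow> 0" by simp
  \<comment> \<open>The constant slope that brings the endpoint value back to \<open>B\<close>; its
    size is at most \<open>D n / (b - a)\<close>.\<close>
  define e where "e n = (B - A - integral {a..b} (\<lambda>s. R n (up s))) / (b - a)" for n
  have e_le: "\<bar>e n\<bar> * (b - a) \<le> D n" for n
  proof -
    have "\<bar>e n\<bar> * (b - a) = \<bar>integral {a..b} (\<lambda>s. R n (up s)) - integral {a..b} (\<lambda>s. p (up s))\<bar>"
      using a_less_b tot by (simp add: e_def)
    also have "\<dots> \<le> D n" unfolding D_def by (rule integral_ceil_diff_le[OF Rpld p]) (use a_less_b in auto)
    finally show ?thesis .
  qed
  have e0: "e \<longlonglongrightarrow> 0"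
  proof (rule Lim_null_comparison[of _ "\<lambda>n. D n / (b - a)"])
    show "\<forall>\<^sub>F n in sequentially. norm (e n) \<le> D n / (b - a)"
      using e_le a_less_b by (simp add: field_simps)
    show "(\<lambda>n. D n / (b - a)) \<longlonglongrightarrow> 0" using tendsto_divide_zero[OF D0] .
  qed
  define q where "q n t = R n t + e n" for n t
  have q_ld: "ld_continuous_on I (kappa I) (q n)" for n
    unfolding ld_continuous_on_def ld_continuous_at_def
  proof (intro ballI conjI impI)
    fix t assume t: "t \<in> kappa I"
    show "continuous (at t within kappa I) (q n)" if "left_dense I t"
      using R[of n] t that unfolding q_def[abs_def] ld_continuous_on_def ld_continuous_at_def
      by (intro continuous_add continuous_const) blast
    assume "right_dense I t"
    then obtain l where "(R n \<longlongrightarrow> l) (at t within kappa I \<inter> {t<..})"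
      using R[of n] t unfolding ld_continuous_on_def ld_continuous_at_def by blast
    from tendsto_add[OF this tendsto_const] show "\<exists>l. (q n \<longlongrightarrow> l) (at t within kappa I \<inter> {t<..})"
      unfolding q_def[abs_def] by blast
  qed
  define z where "z n t = A + integral {a..t} (\<lambda>s. q n (up s))" for n t
  have z_C1: "C1_ld I (z n)" for n
    unfolding z_def[abs_def] by (rule C1_ld_indefinite_integral(1)[OF q_ld])
  have z_deriv: "nabla_deriv I (z n) t = q n t" if "t \<in> kappa I" for n t
    unfolding z_def[abs_def] by (rule C1_ld_indefinite_integral(2)[OF q_ld that])
  have z_eq: "z n t = A + integral {a..t} (\<lambda>s. R n (up s)) + e n * (t - a)" if "t \<in> {a..b}" for n t
  proof -
    have "(\<lambda>s. R n (up s)) integrable_on {a..t}" using pld_integrable_sub[OF Rpld] that by simp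
    then show ?thesis
      unfolding z_def q_def using that by (subst integral_add) auto
  qed
  \<comment> \<open>One \<open>D n\<close> pays for replacing \<open>p\<close> by
    \<open>R n\<close>, the other for the correction \<open>e n\<close>.\<close>
  have z_near: "\<bar>z n t - y t\<bar> \<le> 2 * D n" if t: "t \<in> I" for n t
  proof -
    have tab: "t \<in> {a..b}" using t I_subset by blast
    have "\<bar>integral {a..t} (\<lambda>s. R n (up s)) - integral {a..t} (\<lambda>s. p (up s))\<bar> \<le> D n"
      unfolding D_def by (rule integral_ceil_diff_le[OF Rpld p tab])
    moreover have "\<bar>e n * (t - a)\<bar> \<le> D n"
    proof -
      have "\<bar>e n * (t - a)\<bar> \<le> \<bar>e n\<bar> * (b - a)" using tab by (simp add: abs_mult mult_left_mono)
      with e_le[of n] show ?thesis by linarith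
    qed
    ultimately show ?thesis unfolding z_eq[OF tab] y[OF t] by linarith
  qed
  have z_b: "z n b = B" for n
    using z_eq[of b n] a_less_b by (simp add: e_def)
  have z_a: "z n a = A" for n by (simp add: z_def)
  have z_cont: "continuous_on I (z n)" for n
    unfolding z_def[abs_def] using continuous_on_subset[OF pld_indefinite_integral_continuous[OF ld_imp_pld[OF q_ld]] I_subset]
    by (intro continuous_intros)
  have y_cont: "continuous_on I y"
  proof -
    have "continuous_on I (\<lambda>t. A + integral {a..t} (\<lambda>s. p (up s)))"
      using continuous_on_subset[OF pld_indefinite_integral_continuous[OF p] I_subset]
      by (intro continuous_intros)
    then show ?thesis using y by (simp cong: continuous_on_cong)
  qed
  define JJ where "JJ n = integral {a..b} (\<lambda>s. L (up s) (z n (rh (up s))) (q n (up s)))" for n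
  have fun_eq: "functional L T a b (z n) = JJ n" for n
  proof -
    have "pld (nabla_deriv I (z n))" using z_C1 by (auto simp: C1_ld_def intro: ld_imp_pld)
    from functional_eq[OF z_cont this]
    have "functional L T a b (z n) = integral {a..b} (\<lambda>s. L (up s) (z n (rh (up s))) (nabla_deriv I (z n) (up s)))" .
    also have "\<dots> = JJ n"
      unfolding JJ_def by (rule integral_spike[of "{a}"]) (use z_deriv ceil_kappa in auto)
    finally show ?thesis .
  qed
  have "\<forall>\<^sub>F n in sequentially. J \<le> JJ n"
  proof -
    have "\<forall>\<^sub>F n in sequentially. D n < \<delta> / 4" using D0 \<open>\<delta> > 0\<close> by (intro order_tendstoD) auto
    then show ?thesis
    proof eventually_elim
      case (elim n)
      have "\<bar>z n t - xb t\<bar> \<le> \<delta>" if "t \<in> I" for t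
        using z_near[OF that, of n] near[OF that] elim by linarith
      with min[OF z_C1 z_a z_b] fun_eq show ?case by metis
    qed
  qed
  moreover have "JJ \<longlonglongrightarrow> integral {a..b} (\<lambda>s. L (up s) (y (rh (up s))) (p (up s)))"
  proof -
    have "compact I" using closed_I I_subset by (meson bounded_closed_interval bounded_subset compact_eq_bounded_closed)
    then have "bounded (y ` I)" using compact_continuous_image[OF y_cont] compact_imp_bounded by blast
    then obtain Y where Y: "\<And>t. t \<in> I \<Longrightarrow> \<bar>y t\<bar> \<le> Y" unfolding bounded_iff by auto
    obtain DB where DB: "\<And>n. \<bar>D n\<bar> \<le> DB"
      using D0 by (metis BseqE convergentI convergent_imp_Bseq real_norm_def)
    obtain EB where EB: "\<And>n. \<bar>e n\<bar> \<le> EB"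
      using e0 by (metis BseqE convergentI convergent_imp_Bseq real_norm_def)
    \<comment> \<open>Common bound for the second and third arguments of \<open>L\<close> along the
      whole sequence.\<close>
    define K where "K = max (Y + 2 * DB) (M + EB)"
    obtain C where C: "\<And>t x r. t \<in> I \<Longrightarrow> \<bar>x\<bar> \<le> K \<Longrightarrow> \<bar>r\<bar> \<le> K \<Longrightarrow> \<bar>L t x r\<bar> \<le> C"
      using L_bounded[of K] by blast
    show ?thesis
      unfolding JJ_def
    proof (rule bounded_convergence_finite[OF _ E'fin])
      show "(\<lambda>s. L (up s) (z n (rh (up s))) (q n (up s))) integrable_on {a..b}" for n
        using pld_integrable[OF integrand_pld[OF z_cont ld_imp_pld[OF q_ld]]] .
      fix s assume s: "s \<in> {a..b} - E'"
      have rI: "rh (up s) \<in> I" "up s \<in> I" "up s \<in> T" using upE[OF s] kappa_subset rho_mem I_T by blast+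
      show "\<bar>L (up s) (z n (rh (up s))) (q n (up s))\<bar> \<le> C" for n
      proof (rule C[OF rI(2)])
        show "\<bar>z n (rh (up s))\<bar> \<le> K" using z_near[OF rI(1), of n] Y[OF rI(1)] DB[of n] by (simp add: K_def)
        show "\<bar>q n (up s)\<bar> \<le> K" using M[OF upE(1)[OF s], of n] EB[of n] by (simp add: K_def q_def)
      qed
      show "(\<lambda>n. L (up s) (z n (rh (up s))) (q n (up s))) \<longlonglongrightarrow> L (up s) (y (rh (up s))) (p (up s))"
      proof (rule tendsto_L_fixed[OF rI(3)])
        have "(\<lambda>n. z n (rh (up s)) - y (rh (up s))) \<longlonglongrightarrow> 0"
          by (rule Lim_null_comparison[of _ "\<lambda>n. 2 * D n"])
            (use z_near[OF rI(1)] tendsto_mult_right_zero[OF D0] in auto)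
        then show "(\<lambda>n. z n (rh (up s))) \<longlonglongrightarrow> y (rh (up s))" by (simp add: LIM_zero_iff)
        have "(\<lambda>n. R n (up s) + e n) \<longlonglongrightarrow> p (up s) + 0"
          using Rp upE[OF s] e0 by (intro tendsto_add) auto
        then show "(\<lambda>n. q n (up s)) \<longlonglongrightarrow> p (up s)" by (simp add: q_def)
      qed
    qed
  qed
  ultimately show ?thesis by (intro tendsto_lowerbound[where F = sequentially]) auto
qed

lemma L_left_dense_delta:
  assumes "t \<in> T" "left_dense T t" "\<epsilon> > 0"
  shows "\<exists>d>0. \<forall>s\<in>T. \<forall>y p. \<bar>s - t\<bar> < d \<longrightarrow> \<bar>y - x\<bar> < d \<longrightarrow> \<bar>p - r\<bar> < d \<longrightarrow> \<bar>L s y p - L t x r\<bar> < \<epsilon>"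
proof -
  have "continuous (at (t, x, r) within T \<times> UNIV) (\<lambda>(s, y, p). L s y p)"
    using ld assms by (simp add: ld_continuous_first_def)
  then obtain d where d: "d > 0" "\<And>w. w \<in> T \<times> UNIV \<Longrightarrow> dist w (t, x, r) < d \<Longrightarrow>
      dist ((\<lambda>(s, y, p). L s y p) w) ((\<lambda>(s, y, p). L s y p) (t, x, r)) < \<epsilon>"
    unfolding continuous_within_eps_delta using \<open>\<epsilon> > 0\<close> by blast
  have "\<bar>L s y p - L t x r\<bar> < \<epsilon>" if "s \<in> T" "\<bar>s - t\<bar> < d / 3" "\<bar>y - x\<bar> < d / 3" "\<bar>p - r\<bar> < d / 3" for s y p
  proof -
    have "dist (s, y, p) (t, x, r) \<le> dist s t + (dist y x + dist p r)"
      by (smt (verit) Pair_inject dist_Pair_Pair sqrt_sum_squares_le_sum zero_le_dist)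
    also have "\<dots> < d" using that by (simp add: dist_real_def)
    finally show ?thesis using d(2)[of "(s, y, p)"] that by (simp add: dist_real_def)
  qed
  with \<open>d > 0\<close> show ?thesis by (intro exI[of _ "d / 3"]) auto
qed

text \<open>On \<open>[u,v]\<close> the derivative is perturbed by \<open>m\<close> on an interval of length \<open>\<kappa> h\<close> and then by
  \<open>-\<kappa> m\<close> on one of length \<open>h\<close>, which leaves the boundary values unchanged.\<close>

lemma weierstrass_two_slopes:
  assumes r: "pld r" and xb_cont: "continuous_on I xb"
    and xb: "\<And>t. t \<in> I \<Longrightarrow> xb t = A + integral {a..t} (\<lambda>s. r (up s))" and "xb b = B"
    and J: "J = integral {a..b} (\<lambda>s. L (up s) (xb (rh (up s))) (r (up s)))" and "\<delta> > 0"
    and min: "\<And>z. C1_ld I z \<Longrightarrow> z a = A \<Longrightarrow> z b = B \<Longrightarrow> (\<And>t. t \<in> I \<Longrightarrow> \<bar>z t - xb t\<bar> \<le> \<delta>)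
      \<Longrightarrow> J \<le> functional L T a b z"
    and t: "t \<in> T" "left_dense T t"
    and near: "\<And>e. e > 0 \<Longrightarrow> \<exists>u v. u < v \<and> {u..v} \<subseteq> I \<and>
      (\<forall>s\<in>{u<..<v}. \<bar>s - t\<bar> < e \<and> \<bar>xb s - x\<bar> < e \<and> \<bar>r s - l\<bar> < e)"
    and "\<kappa> > 0"
  shows "\<kappa> * L t x (l + m) + L t x (l - \<kappa> * m) - (1 + \<kappa>) * L t x l \<ge> 0"
proof -
  \<comment> \<open>One \<open>\<epsilon>\<close> pays for replacing \<open>L\<close> on a perturbed
    piece by its value at the limit point, the other for replacing the unperturbed integrand by
    \<open>L t x l\<close>.\<close>
  have main: "0 \<le> \<kappa> * (L t x (l + m) - L t x l + 2 * \<epsilon>) + (L t x (l - \<kappa> * m) - L t x l + 2 * \<epsilon>)"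
    if eps: "\<epsilon> > 0" for \<epsilon>
  proof -
    define c1 where "c1 = L t x (l + m) - L t x l + 2 * \<epsilon>"
    define c2 where "c2 = L t x (l - \<kappa> * m) - L t x l + 2 * \<epsilon>"
    obtain d0 where d0: "d0 > 0" "\<And>s y p. s \<in> T \<Longrightarrow> \<bar>s - t\<bar> < d0 \<Longrightarrow> \<bar>y - x\<bar> < d0 \<Longrightarrow> \<bar>p - l\<bar> < d0 \<Longrightarrow> \<bar>L s y p - L t x l\<bar> < \<epsilon>"
      using L_left_dense_delta[OF t eps, of x l] by blast
    obtain d1 where d1: "d1 > 0" "\<And>s y p. s \<in> T \<Longrightarrow> \<bar>s - t\<bar> < d1 \<Longrightarrow> \<bar>y - x\<bar> < d1 \<Longrightarrow> \<bar>p - (l + m)\<bar> < d1 \<Longrightarrow> \<bar>L s y p - L t x (l + m)\<bar> < \<epsilon>"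
      using L_left_dense_delta[OF t eps, of x "l + m"] by blast
    obtain d2 where d2: "d2 > 0" "\<And>s y p. s \<in> T \<Longrightarrow> \<bar>s - t\<bar> < d2 \<Longrightarrow> \<bar>y - x\<bar> < d2 \<Longrightarrow> \<bar>p - (l - \<kappa> * m)\<bar> < d2 \<Longrightarrow> \<bar>L s y p - L t x (l - \<kappa> * m)\<bar> < \<epsilon>"
      using L_left_dense_delta[OF t eps, of x "l - \<kappa> * m"] by blast
    define d where "d = min d0 (min d1 d2)"
    have "d > 0" using d0 d1 d2 by (simp add: d_def)
    obtain u v where uv: "u < v" "{u..v} \<subseteq> I"
      and s_near: "\<And>s. u < s \<Longrightarrow> s < v \<Longrightarrow> \<bar>s - t\<bar> < d / 2 \<and> \<bar>xb s - x\<bar> < d / 2 \<and> \<bar>r s - l\<bar> < d / 2"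
      using near[of "d / 2"] \<open>d > 0\<close> by (auto simp: greaterThanLessThan_iff)
    \<comment> \<open>Starting strictly above \<open>u\<close> makes all break points left-dense, as
      the steps require.\<close>
    define s0 where "s0 = (u + v) / 2"
    \<comment> \<open>The first bound keeps both pieces below \<open>v\<close>; the second keeps the
      amplitude \<open>\<kappa> * \<bar>m\<bar> * h\<close> within \<open>\<delta> / 2\<close> and
      \<open>d / 2\<close>. The summand 1 covers \<open>m = 0\<close>.\<close>
    define h where "h = min ((v - s0) / (2 * (1 + \<kappa>))) (min (\<delta> / 2) (d / 2) / (\<kappa> * \<bar>m\<bar> + 1))"
    have \<kappa>m: "\<kappa> * \<bar>m\<bar> + 1 > 0" using \<open>\<kappa> > 0\<close> by (simp add: add_nonneg_pos)
    have "h > 0" using uv \<open>\<kappa> > 0\<close> \<kappa>m \<open>\<delta> > 0\<close> \<open>d > 0\<close> by (simp add: h_def s0_def)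
    have amp: "\<kappa> * \<bar>m\<bar> * h \<le> min (\<delta> / 2) (d / 2)"
    proof -
      have "h \<le> min (\<delta> / 2) (d / 2) / (\<kappa> * \<bar>m\<bar> + 1)" by (simp add: h_def)
      then have "h * (\<kappa> * \<bar>m\<bar> + 1) \<le> min (\<delta> / 2) (d / 2)" using \<kappa>m by (simp only: pos_le_divide_eq)
      then show ?thesis using \<open>h > 0\<close> by (simp add: algebra_simps)
    qed
    have hv: "(1 + \<kappa>) * h < v - s0"
    proof -
      have "h \<le> (v - s0) / (2 * (1 + \<kappa>))" by (simp add: h_def)
      then have "2 * ((1 + \<kappa>) * h) \<le> v - s0" using \<open>\<kappa> > 0\<close> by (simp add: field_simps)
      moreover have "(1 + \<kappa>) * h > 0" using \<open>\<kappa> > 0\<close> \<open>h > 0\<close> by simp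
      ultimately show ?thesis by linarith
    qed
    define s1 where "s1 = s0 + \<kappa> * h"
    define s2 where "s2 = s1 + h"
    have ord: "u < s0" "s0 < s1" "s1 < s2" "s2 < v"
      using uv hv \<open>\<kappa> > 0\<close> \<open>h > 0\<close> by (auto simp: s0_def s1_def s2_def algebra_simps)
    have sI: "s \<in> I" if "u \<le> s" "s \<le> v" for s using uv that by auto
    have s012: "s0 \<in> I" "s1 \<in> I" "s2 \<in> I" using ord by (auto intro!: sI)
    have ldI: "rh s = s" if "u < s" "s \<le> v" for s using interval_rho[OF uv(2) that] .
    have ld012: "left_dense I s0" "left_dense I s1" "left_dense I s2"
      unfolding left_dense_def using ord by (auto intro!: ldI)
    define H :: "real \<Rightarrow> real \<Rightarrow> real" where "H c s = (if c < s then 1 else 0)" for c s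
    have Hpld: "pld (H c)" if "left_dense I c" for c
      using pld_step[OF that] by (simp add: H_def[abs_def])
    \<comment> \<open>Equals \<open>m\<close> on \<open>(s0, s1]\<close>,
      \<open>- \<kappa> * m\<close> on \<open>(s1, s2]\<close>, and zero afterwards since the
      coefficients sum to zero. Written in steps, it inherits piecewise ld-continuity and an
      explicit integral.\<close>
    define w where "w s = m * H s0 s + (- (m + \<kappa> * m) * H s1 s + \<kappa> * m * H s2 s)" for s
    have wpld: "pld w"
      unfolding w_def by (intro pld_add pld_mult pld_const Hpld ld012)
    \<comment> \<open>The primitive of \<open>w\<close>: a tent reaching
      \<open>\<kappa> * m * h\<close> at \<open>s1\<close> and returning to zero at
      \<open>s2\<close>.\<close>
    define \<phi> where "\<phi> s = m * max 0 (s - s0) + (- (m + \<kappa> * m) * max 0 (s - s1) + \<kappa> * m * max 0 (s - s2))" for s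
    have H_int: "((\<lambda>s. H c (up s)) has_integral max 0 (\<tau> - c)) {a..\<tau>}" if "c \<in> I" "\<tau> \<in> I" for c \<tau>
      unfolding H_def using that I_subset by (intro step_has_integral) auto
    have w_int: "((\<lambda>s. w (up s)) has_integral \<phi> \<tau>) {a..\<tau>}" if "\<tau> \<in> I" for \<tau>
      unfolding w_def \<phi>_def by (intro has_integral_add has_integral_mult_right H_int s012 that)
    have phi_s2: "\<phi> s = 0" if "s \<ge> s2" for s
      using that ord by (simp add: \<phi>_def s2_def s1_def algebra_simps)
    have phi_s0: "\<phi> s = 0" if "s \<le> s0" for s
      using that ord by (simp add: \<phi>_def)
    have phi_le: "\<bar>\<phi> s\<bar> \<le> \<kappa> * \<bar>m\<bar> * h" for s
    proof -
      have nn: "\<kappa> * \<bar>m\<bar> * h \<ge> 0" using \<open>\<kappa> > 0\<close> \<open>h > 0\<close> by simp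
      consider "s \<le> s0" | "s0 < s" "s \<le> s1" | "s1 < s" "s < s2" | "s2 \<le> s" by linarith
      then show ?thesis
      proof cases
        case 2
        then have "\<phi> s = m * (s - s0)" using ord by (simp add: \<phi>_def)
        then have "\<bar>\<phi> s\<bar> = \<bar>m\<bar> * (s - s0)" using 2 by (simp add: abs_mult)
        also have "\<dots> \<le> \<bar>m\<bar> * (\<kappa> * h)" using 2 by (intro mult_left_mono) (auto simp: s1_def)
        finally show ?thesis by (simp add: algebra_simps)
      next
        case 3
        then have "\<phi> s = \<kappa> * m * (s2 - s)" using ord by (simp add: \<phi>_def s2_def s1_def algebra_simps)
        then have "\<bar>\<phi> s\<bar> = \<kappa> * \<bar>m\<bar> * (s2 - s)" using 3 \<open>\<kappa> > 0\<close> by (simp add: abs_mult)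
        also have "\<dots> \<le> \<kappa> * \<bar>m\<bar> * h" using 3 \<open>\<kappa> > 0\<close> by (intro mult_left_mono) (auto simp: s2_def)
        finally show ?thesis .
      qed (use nn phi_s0 phi_s2 in auto)
    qed
    define p where "p s = r s + w s" for s
    have ppld: "pld p" unfolding p_def by (intro pld_add r wpld)
    define y where "y s = xb s + \<phi> s" for s
    have y_eq: "y \<tau> = A + integral {a..\<tau>} (\<lambda>s. p (up s))" if "\<tau> \<in> I" for \<tau>
    proof -
      have "\<tau> \<le> b" using that le_b by blast
      have "integral {a..\<tau>} (\<lambda>s. p (up s)) = integral {a..\<tau>} (\<lambda>s. r (up s)) + integral {a..\<tau>} (\<lambda>s. w (up s))"
        unfolding p_def using pld_integrable_sub[OF r \<open>\<tau> \<le> b\<close>] pld_integrable_sub[OF wpld \<open>\<tau> \<le> b\<close>]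
        by (rule integral_add)
      then show ?thesis using w_int[OF that] xb[OF that] by (simp add: y_def integral_unique)
    qed
    have bs2: "b \<ge> s2" using le_b s012 by blast
    have y_cont: "continuous_on I y"
      unfolding y_def \<phi>_def by (intro continuous_intros xb_cont)
    have "J \<le> integral {a..b} (\<lambda>s. L (up s) (y (rh (up s))) (p (up s)))"
    proof (rule comparison[OF ppld _ \<open>\<delta> > 0\<close> y_eq _ min])
      show "A + integral {a..b} (\<lambda>s. p (up s)) = B"
        using y_eq[OF b_in] phi_s2[OF bs2] \<open>xb b = B\<close> by (simp add: y_def)
      show "\<bar>y \<tau> - xb \<tau>\<bar> \<le> \<delta> / 2" for \<tau>
        using phi_le[of \<tau>] amp by (simp add: y_def)
    qed
    \<comment> \<open>The integrand grows by at most \<open>c1\<close> on the first piece and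
      \<open>c2\<close> on the second; this bound is again coded by steps.\<close>
    also have "\<dots> \<le> integral {a..b} (\<lambda>s. L (up s) (xb (rh (up s))) (r (up s))
        + (c1 * H s0 (up s) + ((c2 - c1) * H s1 (up s) + (- c2) * H s2 (up s))))"
    proof (rule integral_le)
      show "(\<lambda>s. L (up s) (y (rh (up s))) (p (up s))) integrable_on {a..b}"
        by (rule pld_integrable[OF integrand_pld[OF y_cont ppld]])
      show "(\<lambda>s. L (up s) (xb (rh (up s))) (r (up s))
        + (c1 * H s0 (up s) + ((c2 - c1) * H s1 (up s) + (- c2) * H s2 (up s)))) integrable_on {a..b}"
        by (rule pld_integrable) (intro pld_add pld_mult pld_const Hpld ld012 integrand_pld xb_cont r)
      fix s assume s: "s \<in> {a..b}"
      define \<tau> where "\<tau> = up s"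
      have \<tau>: "\<tau> \<in> I" "\<tau> \<in> T" using ceil_mem[of s] s I_T by (auto simp: \<tau>_def)
      have tau_near: "L \<tau> (xb \<tau>) (r \<tau>) \<ge> L t x l - \<epsilon> \<and> rh \<tau> = \<tau> \<and> \<bar>\<tau> - t\<bar> < d \<and> \<bar>y \<tau> - x\<bar> < d \<and> \<bar>r \<tau> - l\<bar> < d"
        if "s0 < \<tau>" "\<tau> \<le> s2"
      proof -
        have n: "\<bar>\<tau> - t\<bar> < d / 2" "\<bar>xb \<tau> - x\<bar> < d / 2" "\<bar>r \<tau> - l\<bar> < d / 2" "rh \<tau> = \<tau>"
          using s_near[of \<tau>] ldI[of \<tau>] that ord by auto
        moreover have "\<bar>\<phi> \<tau>\<bar> \<le> d / 2" using phi_le[of \<tau>] amp by linarith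
        moreover have "\<bar>L \<tau> (xb \<tau>) (r \<tau>) - L t x l\<bar> < \<epsilon>"
          using n \<open>d > 0\<close> by (intro d0(2) \<tau>) (auto simp: d_def)
        ultimately show ?thesis using \<open>d > 0\<close> unfolding y_def by (intro conjI) linarith+
      qed
      consider "\<tau> \<le> s0" | "s0 < \<tau>" "\<tau> \<le> s1" | "s1 < \<tau>" "\<tau> \<le> s2" | "s2 < \<tau>" by linarith
      then have "L \<tau> (y (rh \<tau>)) (p \<tau>) \<le> L \<tau> (xb (rh \<tau>)) (r \<tau>)
        + (c1 * H s0 \<tau> + ((c2 - c1) * H s1 \<tau> + (- c2) * H s2 \<tau>))"
      proof cases
        case 1
        then have "\<phi> (rh \<tau>) = 0" using rho_le[OF \<tau>(1)] by (intro phi_s0) simp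
        with 1 ord show ?thesis by (simp add: y_def p_def w_def H_def)
      next
        case 2
        then have n: "L \<tau> (xb \<tau>) (r \<tau>) \<ge> L t x l - \<epsilon>" "rh \<tau> = \<tau>" "\<bar>\<tau> - t\<bar> < d" "\<bar>y \<tau> - x\<bar> < d" "\<bar>r \<tau> - l\<bar> < d"
          using tau_near ord by auto
        have "p \<tau> = r \<tau> + m" using 2 ord by (simp add: p_def w_def H_def)
        then have "\<bar>L \<tau> (y \<tau>) (p \<tau>) - L t x (l + m)\<bar> < \<epsilon>"
          using n by (intro d1(2) \<tau>) (auto simp: d_def)
        then have "L \<tau> (y \<tau>) (p \<tau>) \<le> L \<tau> (xb \<tau>) (r \<tau>) + c1" using n(1) unfolding c1_def by linarith
        with 2 ord n(2) show ?thesis by (simp add: H_def)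
      next
        case 3
        then have n: "L \<tau> (xb \<tau>) (r \<tau>) \<ge> L t x l - \<epsilon>" "rh \<tau> = \<tau>" "\<bar>\<tau> - t\<bar> < d" "\<bar>y \<tau> - x\<bar> < d" "\<bar>r \<tau> - l\<bar> < d"
          using tau_near ord by auto
        have "p \<tau> = r \<tau> - \<kappa> * m" using 3 ord by (simp add: p_def w_def H_def algebra_simps)
        then have "\<bar>L \<tau> (y \<tau>) (p \<tau>) - L t x (l - \<kappa> * m)\<bar> < \<epsilon>"
          using n by (intro d2(2) \<tau>) (auto simp: d_def)
        then have "L \<tau> (y \<tau>) (p \<tau>) \<le> L \<tau> (xb \<tau>) (r \<tau>) + c2" using n(1) unfolding c2_def by linarith
        with 3 ord n(2) show ?thesis by (simp add: H_def)
      next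
        case 4
        \<comment> \<open>As \<open>s2\<close> belongs to \<open>I\<close>, no gap straddles it:
          \<open>s2 \<le> rh \<tau>\<close> even if \<open>\<tau>\<close> is left-scattered.\<close>
        then have "\<phi> (rh \<tau>) = 0" using le_rho[OF s012(3) \<tau>(1)] by (intro phi_s2) simp
        with 4 ord show ?thesis by (simp add: y_def p_def w_def H_def algebra_simps)
      qed
      then show "L (up s) (y (rh (up s))) (p (up s)) \<le> L (up s) (xb (rh (up s))) (r (up s))
        + (c1 * H s0 (up s) + ((c2 - c1) * H s1 (up s) + (- c2) * H s2 (up s)))"
        by (simp add: \<tau>_def)
    qed
    also have "\<dots> = J + (c1 * max 0 (b - s0) + ((c2 - c1) * max 0 (b - s1) + (- c2) * max 0 (b - s2)))"
      unfolding J
      by (intro integral_unique has_integral_add has_integral_mult_right H_int s012 b_in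
          integrable_integral pld_integrable integrand_pld xb_cont r)
    also have "c1 * max 0 (b - s0) + ((c2 - c1) * max 0 (b - s1) + (- c2) * max 0 (b - s2)) = h * (\<kappa> * c1 + c2)"
      using bs2 ord by (simp add: s2_def s1_def algebra_simps)
    finally have "0 \<le> h * (\<kappa> * c1 + c2)" by simp
    then show ?thesis using \<open>h > 0\<close> by (simp add: zero_le_mult_iff c1_def c2_def)
  qed
  show ?thesis
  proof (rule field_le_epsilon)
    fix e :: real assume "e > 0"
    define \<eta> where "\<eta> = e / (2 * (1 + \<kappa>))"
    have "\<eta> > 0" using \<open>e > 0\<close> \<open>\<kappa> > 0\<close> by (simp add: \<eta>_def)
    moreover have "(1 + \<kappa>) * (2 * \<eta>) = e" using \<open>\<kappa> > 0\<close> by (simp add: \<eta>_def field_simps)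
    ultimately show "0 \<le> \<kappa> * L t x (l + m) + L t x (l - \<kappa> * m) - (1 + \<kappa>) * L t x l + e"
      using main[of \<eta>] by (simp add: algebra_simps)
  qed
qed

end

text \<open>Only the slope \<open>l - \<kappa> * m\<close> approaches \<open>l\<close>, while
  \<open>l + m\<close> stays fixed; this asymmetry is what compares \<open>g\<close> with its
  tangent at a finite distance.\<close>

lemma two_slopes_imp_tangent:
  fixes g :: "real \<Rightarrow> real"
  assumes g: "(g has_real_derivative D) (at l)"
    and two: "\<And>\<kappa>. \<kappa> > 0 \<Longrightarrow> \<kappa> * g (l + m) + g (l - \<kappa> * m) - (1 + \<kappa>) * g l \<ge> 0"
  shows "g (l + m) - g l - m * D \<ge> 0"
proof -
  have "((\<lambda>\<kappa>. g (l - \<kappa> * m)) has_real_derivative D * (- m)) (at 0)"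
    by (rule DERIV_chain2[of g]) (use g in \<open>auto intro!: derivative_eq_intros\<close>)
  then have "((\<lambda>\<kappa>. (g (l - \<kappa> * m) - g l) / \<kappa>) \<longlongrightarrow> - (m * D)) (at 0)"
    by (simp add: has_field_derivative_iff mult.commute)
  then have "((\<lambda>\<kappa>. g (l + m) - g l + (g (l - \<kappa> * m) - g l) / \<kappa>) \<longlongrightarrow> g (l + m) - g l + - (m * D)) (at_right 0)"
    by (intro tendsto_intros) (auto intro: tendsto_within_subset)
  moreover have "\<forall>\<^sub>F \<kappa> in at_right 0. 0 \<le> g (l + m) - g l + (g (l - \<kappa> * m) - g l) / \<kappa>"
  proof -
    have "0 \<le> g (l + m) - g l + (g (l - \<kappa> * m) - g l) / \<kappa>" if "\<kappa> > 0" for \<kappa>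
    proof -
      have "g (l + m) - g l + (g (l - \<kappa> * m) - g l) / \<kappa> = (\<kappa> * g (l + m) + g (l - \<kappa> * m) - (1 + \<kappa>) * g l) / \<kappa>"
        using that by (simp add: field_simps)
      then show ?thesis using two[OF that] that by simp
    qed
    then show ?thesis by (auto simp: eventually_at_right_field intro: gt_ex)
  qed
  ultimately have "0 \<le> g (l + m) - g l + - (m * D)"
    by (intro tendsto_lowerbound[where F = "at_right (0::real)"]) auto
  then show ?thesis by simp
qed

section \<open>The excess inequality\<close>

context compact_time_scale
begin

text \<open>A real \<open>x\<close> in a gap would have a left-scattered ceiling; here the ceiling
  is left-dense, hence equal to \<open>x\<close>.\<close>

lemma interval_subset_of_left_dense:
  assumes "c \<in> I" "d \<in> I" "\<And>s. s \<in> I \<Longrightarrow> c < s \<Longrightarrow> s \<le> d \<Longrightarrow> left_dense I s"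
  shows "{c..d} \<subseteq> I"
proof
  fix x assume x: "x \<in> {c..d}"
  show "x \<in> I"
  proof (cases "x = c")
    case False
    with x have cx: "c < x" and xb: "x \<le> b" using le_b[OF assms(2)] by auto
    then have "left_dense I (up x)"
      using ceil_mem[OF xb] ceil_ge[OF xb] ceil_le[OF assms(2), of x] x by (intro assms(3)) auto
    then have "up x = x" using ceil_left_dense[OF xb] cx ge_a[OF assms(1)] by simp
    with ceil_mem[OF xb] show ?thesis by simp
  qed (use assms in simp)
qed

text \<open>Continuity alone gives nabla differentiability at left-scattered points, so the finitely
  many exceptions are left-dense, as the uniqueness of antiderivatives demands.\<close>

lemma C1_pld_eq_integral:
  assumes "C1_pld I f" "u \<in> I"
  shows "f u = f a + integral {a..u} (\<lambda>s. nabla_deriv I f (up s))"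
proof (rule antiderivative_eq_integral)
  show "continuous_on I f" and "pld (nabla_deriv I f)"
    and "finite {t \<in> kappa I. \<not> nabla_differentiable I f t}"
    using assms by (auto simp: C1_pld_def)
  show "left_dense I t" if "t \<in> {t \<in> kappa I. \<not> nabla_differentiable I f t}" for t
  proof (rule ccontr)
    assume "\<not> left_dense I t"
    moreover have "t \<in> I" using that kappa_subset by blast
    moreover from this have "continuous (at t within I) f"
      using \<open>continuous_on I f\<close> by (simp add: continuous_on_eq_continuous_within)
    ultimately show False using left_scattered_has_nabla_deriv that by (auto simp: nabla_differentiable_def)
  qed
  show "has_nabla_deriv I f t (nabla_deriv I f t)" if "t \<in> kappa I - {t \<in> kappa I. \<not> nabla_differentiable I f t}" for t
    using that by (intro has_nabla_deriv_nabla_deriv) auto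
qed (fact assms)

text \<open>Differentiating the integral representation turns the left limit of the derivative into
  a left derivative, whatever happens at \<open>t\<close> itself.\<close>

lemma C1_pld_left_derivative:
  assumes f: "C1_pld I f" and t: "t \<in> I" "a < t" "left_dense I t"
    and l: "(nabla_deriv I f \<longlongrightarrow> l) (at t within kappa I \<inter> {..<t})"
  shows "(f has_real_derivative l) (at t within I \<inter> {..t})"
proof -
  have "pld (nabla_deriv I f)" using f by (simp add: C1_pld_def)
  from pld_indefinite_integral_left_derivative[OF this t l]
  have "((\<lambda>u. f a + integral {a..u} (\<lambda>s. nabla_deriv I f (up s))) has_real_derivative l) (at t within I \<inter> {..t})"
    by (auto intro!: derivative_eq_intros)
  then show ?thesis
    by (rule has_field_derivative_transform_within[OF _ zero_less_one])
      (use t C1_pld_eq_integral[OF f] in auto)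
qed

lemma C1_pld_right_derivative:
  assumes f: "C1_pld I f" and t: "t \<in> I" "t < b" "right_dense I t"
    and l: "(nabla_deriv I f \<longlongrightarrow> l) (at t within kappa I \<inter> {t<..})"
  shows "(f has_real_derivative l) (at t within I \<inter> {t..})"
proof -
  have "pld (nabla_deriv I f)" using f by (simp add: C1_pld_def)
  from pld_indefinite_integral_right_derivative[OF this t l]
  have "((\<lambda>u. f a + integral {a..u} (\<lambda>s. nabla_deriv I f (up s))) has_real_derivative l) (at t within I \<inter> {t..})"
    by (auto intro!: derivative_eq_intros)
  then show ?thesis
    by (rule has_field_derivative_transform_within[OF _ zero_less_one])
      (use t C1_pld_eq_integral[OF f] in auto)
qed

text \<open>Both numbers are derivatives within \<open>I \<inter> {..t}\<close>, where
  \<open>t\<close> is an accumulation point. An existing derivative is thus covered by the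
  inequality for the left limit.\<close>

lemma C1_pld_nabla_deriv_eq_left:
  assumes f: "C1_pld I f" and t: "t \<in> I" "a < t" "left_dense I t"
    and l: "(nabla_deriv I f \<longlongrightarrow> l) (at t within kappa I \<inter> {..<t})" and d: "nabla_differentiable I f t"
  shows "nabla_deriv I f t = l"
proof -
  have "(f has_real_derivative nabla_deriv I f t) (at t within I)"
    using has_nabla_deriv_nabla_deriv[OF d] t by (simp add: left_dense_has_nabla_deriv_iff)
  then have "(f has_real_derivative nabla_deriv I f t) (at t within I \<inter> {..t})"
    by (rule has_field_derivative_subset) auto
  moreover have "at t within I \<inter> {..t} \<noteq> bot"
  proof -
    have "at t within kappa I \<inter> {..<t} \<le> at t within I \<inter> {..t}"
      using kappa_subset by (intro at_le) auto
    then show ?thesis using at_left_kappa_neq_bot[OF t] bot_unique by metis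
  qed
  ultimately show ?thesis
    using C1_pld_left_derivative[OF f t l] vector_derivative_unique_within
    by (metis has_real_derivative_iff_has_vector_derivative)
qed

text \<open>Nothing of \<open>I\<close> lies to the left of \<open>a\<close>, so the right limit is
  already the derivative and \<open>a\<close> cannot be a corner.\<close>

lemma C1_pld_differentiable_a:
  assumes f: "C1_pld I f" and rd: "right_dense I a"
    and l: "(nabla_deriv I f \<longlongrightarrow> l) (at a within kappa I \<inter> {a<..})"
  shows "has_nabla_deriv I f a l"
  using C1_pld_right_derivative[OF f a_in a_less_b rd l] has_derivative_left_trivial
    a_kappa_iff rd left_dense_a
  by (auto simp: left_dense_has_nabla_deriv_iff intro: has_derivative_two_sided)

text \<open>At an end of \<open>I\<close>, or before a gap on the right, one side imposes no
  condition and the other already yields a derivative. A corner is therefore approached from both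
  sides, and both limits in the conclusion are genuine.\<close>

lemma C1_pld_not_differentiableD:
  assumes f: "C1_pld I f" and t: "t \<in> kappa I" "left_dense I t" and nd: "\<not> nabla_differentiable I f t"
  shows "a < t" "t < b" "right_dense I t"
proof -
  have p: "pld (nabla_deriv I f)" using f by (simp add: C1_pld_def)
  have tI: "t \<in> I" using t kappa_subset by blast
  show at: "a < t"
  proof (rule ccontr)
    assume "\<not> a < t"
    with kappa_cases[OF t(1)] have "t = a" "right_dense I a" by auto
    with C1_pld_differentiable_a[OF f] pldD_right[OF p t(1)] nd show False
      unfolding nabla_differentiable_def by blast
  qed
  have "t < b \<and> right_dense I t"
  proof (rule ccontr)
    assume *: "\<not> (t < b \<and> right_dense I t)"
    obtain l where l: "(nabla_deriv I f \<longlongrightarrow> l) (at t within kappa I \<inter> {..<t})"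
      using pldD_left[OF p t] by blast
    have "(f has_real_derivative l) (at t within I)"
      using C1_pld_left_derivative[OF f tI at t(2) l] has_derivative_right_trivial[OF tI *]
      by (rule has_derivative_two_sided)
    with t nd show False unfolding nabla_differentiable_def
      by (auto simp: left_dense_has_nabla_deriv_iff)
  qed
  then show "t < b" "right_dense I t" by auto
qed

end

context lagrangian
begin

text \<open>A point of \<open>T\<close> below \<open>s\<close> either lies in \<open>I\<close>,
  hence at most at \<open>rh s\<close>, or lies below \<open>a \<le> rh s\<close>; a gap of
  \<open>I\<close> is a gap of \<open>T\<close>.\<close>

lemma left_scattered_nu_pos:
  assumes "s \<in> I" "\<not> left_dense I s" shows "ts_nu T s > 0"
proof -
  note lt = not_left_denseD[OF assms]
  have ne: "{x \<in> T. x < s} \<noteq> {}" using a_in lt I_T by blast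
  have "Sup {x \<in> T. x < s} \<le> rh s"
  proof (rule cSup_least[OF ne])
    fix x assume x: "x \<in> {x \<in> T. x < s}"
    show "x \<le> rh s"
    proof (cases "a \<le> x")
      case True
      with x le_b[OF assms(1)] have "x \<in> I" by (auto simp: I_T)
      then show ?thesis using x assms(1) by (intro le_rho) auto
    next
      case False
      then show ?thesis using ge_a[OF rho_mem[OF assms(1)]] by linarith
    qed
  qed
  then have "ts_rho T s < s" using ne lt by (simp only: ts_rho_def if_False)
  then show ?thesis by (simp add: ts_nu_def)
qed

lemma nu_pos_or_left_dense:
  assumes "s \<in> T" shows "ts_nu T s > 0 \<or> left_dense T s"
proof -
  have "ts_rho T s \<le> s"
  proof (cases "{x \<in> T. x < s} = {}")
    case True
    then have "Inf T = s" using assms by (intro cInf_eq_minimum) (auto simp: not_less)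
    then show ?thesis using True by (simp only: ts_rho_def refl if_True)
  next
    case False
    then have "Sup {x \<in> T. x < s} \<le> s" by (intro cSup_least) auto
    then show ?thesis using False by (simp only: ts_rho_def if_False)
  qed
  then show ?thesis by (auto simp: ts_nu_def left_dense_def)
qed

lemma L_has_deriv:
  assumes "t \<in> T" shows "(L t x has_real_derivative deriv (L t x) r) (at r)"
proof -
  obtain D :: "real \<times> real \<Rightarrow> (real \<times> real) \<Rightarrow>\<^sub>L real"
    where D: "\<And>z. ((\<lambda>(x, r). L t x r) has_derivative blinfun_apply (D z)) (at z)"
    using C2[OF assms] unfolding C2_fun_def by blast
  have "((\<lambda>r. (x, r)) has_derivative (\<lambda>h. (0, h))) (at r)"
    by (auto intro!: derivative_eq_intros)
  from diff_chain_at[OF this D[of "(x, r)"]]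
  have "(L t x has_derivative (\<lambda>h. D (x, r) (0, h))) (at r)" by (simp add: o_def)
  then have "L t x differentiable (at r)" unfolding differentiable_def by blast
  then show ?thesis by (simp add: DERIV_deriv_iff_real_differentiable)
qed

lemma excess_nonneg_if_convex:
  assumes "t \<in> T" "convex_on UNIV (L t x)" shows "excess L t x r q \<ge> 0"
  using convex_on_imp_above_tangent[OF assms(2) _ _ _ L_has_deriv[OF assms(1)], of r q]
  by (simp add: excess_def algebra_simps)

lemma convex_if_nu_pos:
  assumes "ts_nu T t > 0"
    and conv: "\<And>r1 r2 \<gamma>. 0 \<le> \<gamma> \<Longrightarrow> \<gamma> \<le> 1 \<Longrightarrow>
           ts_nu T t * L t x (\<gamma> * r1 + (1 - \<gamma>) * r2)
             \<le> ts_nu T t * \<gamma> * L t x r1 + ts_nu T t * (1 - \<gamma>) * L t x r2"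
  shows "convex_on UNIV (L t x)"
proof (rule convex_onI)
  fix g r1 r2 :: real assume g: "0 < g" "g < 1"
  have "ts_nu T t * L t x ((1 - g) * r1 + g * r2) \<le> ts_nu T t * ((1 - g) * L t x r1 + g * L t x r2)"
    using conv[of "1 - g" r1 r2] g by (simp add: algebra_simps)
  then show "L t x ((1 - g) *\<^sub>R r1 + g *\<^sub>R r2) \<le> (1 - g) * L t x r1 + g * L t x r2"
    using assms(1) by (simp add: mult_le_cancel_left)
qed simp

text \<open>Each instance of convexity involves three values of \<open>L s x\<close>, which converge
  to those of \<open>L t x\<close> because \<open>t\<close> is left-dense in
  \<open>T\<close>.\<close>

lemma convex_if_limit_of_convex:
  assumes t: "t \<in> T" "left_dense T t"
    and conv: "\<And>e. e > 0 \<Longrightarrow> \<exists>s\<in>T. \<bar>s - t\<bar> < e \<and> convex_on UNIV (L s x)"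
  shows "convex_on UNIV (L t x)"
proof (rule convex_onI)
  fix g r1 r2 :: real assume g: "0 < g" "g < 1"
  let ?r = "(1 - g) * r1 + g * r2"
  have "L t x ?r \<le> (1 - g) * L t x r1 + g * L t x r2"
  proof (rule field_le_epsilon)
    fix e :: real assume "e > 0"
    then have e: "e / 2 > 0" by simp
    have "\<exists>d>0. \<forall>s\<in>T. \<bar>s - t\<bar> < d \<longrightarrow> \<bar>L s x r - L t x r\<bar> < e / 2" for r
    proof -
      obtain d where "d > 0" "\<forall>s\<in>T. \<forall>y p. \<bar>s - t\<bar> < d \<longrightarrow> \<bar>y - x\<bar> < d \<longrightarrow> \<bar>p - r\<bar> < d \<longrightarrow> \<bar>L s y p - L t x r\<bar> < e / 2"
        using L_left_dense_delta[OF t e, of x r] by blast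
      then show ?thesis by (intro exI[of _ d]) auto
    qed
    then obtain d where d: "\<And>r. d r > 0" "\<And>r s. s \<in> T \<Longrightarrow> \<bar>s - t\<bar> < d r \<Longrightarrow> \<bar>L s x r - L t x r\<bar> < e / 2"
      by metis
    obtain s where s: "s \<in> T" "\<bar>s - t\<bar> < min (d ?r) (min (d r1) (d r2))" "convex_on UNIV (L s x)"
      using conv[of "min (d ?r) (min (d r1) (d r2))"] d(1) by auto
    have "L s x ?r \<le> (1 - g) * L s x r1 + g * L s x r2"
      using convex_onD[OF s(3), of g r1 r2] g by simp
    moreover have "\<bar>L s x ?r - L t x ?r\<bar> < e / 2" "\<bar>L s x r1 - L t x r1\<bar> < e / 2" "\<bar>L s x r2 - L t x r2\<bar> < e / 2"
      using d(2) s by auto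
    moreover from this have "L s x r1 \<le> L t x r1 + e / 2" "L s x r2 \<le> L t x r2 + e / 2"
      by linarith+
    then have "(1 - g) * L s x r1 \<le> (1 - g) * (L t x r1 + e / 2)" "g * L s x r2 \<le> g * (L t x r2 + e / 2)"
      using g by (auto intro!: mult_left_mono)
    moreover have "(1 - g) * (L t x r1 + e / 2) + g * (L t x r2 + e / 2) = (1 - g) * L t x r1 + g * L t x r2 + e / 2"
      by (simp add: field_simps)
    ultimately show "L t x ?r \<le> (1 - g) * L t x r1 + g * L t x r2 + e" by linarith
  qed
  then show "L t x ((1 - g) *\<^sub>R r1 + g *\<^sub>R r2) \<le> (1 - g) * L t x r1 + g * L t x r2" by simp
qed simp

text \<open>Near a left-dense point either left-scattered points accumulate, and convexity passes to the
  limit, or the time scale is an interval, and the two-slope variation applies.\<close>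

lemma excess_nonneg_at_one_sided_limit:
  assumes f: "C1_pld I xb" and min: "strong_local_min L T a b A B xb"
    and conv: "\<And>t x r1 r2 \<gamma>. t \<in> kappa I \<Longrightarrow> 0 \<le> \<gamma> \<Longrightarrow> \<gamma> \<le> 1 \<Longrightarrow>
           ts_nu T t * L t x (\<gamma> * r1 + (1 - \<gamma>) * r2)
             \<le> ts_nu T t * \<gamma> * L t x r1 + ts_nu T t * (1 - \<gamma>) * L t x r2"
    and t: "t \<in> I" "left_dense T t"
    and side: "(a < t \<and> left_dense I t \<and> X = {..<t}) \<or> (t < b \<and> right_dense I t \<and> X = {t<..})"
    and l: "(nabla_deriv I xb \<longlongrightarrow> l) (at t within kappa I \<inter> X)"
  shows "excess L t (xb t) l q \<ge> 0"
proof (cases "\<forall>e>0. \<exists>s\<in>kappa I. \<bar>s - t\<bar> < e \<and> ts_nu T s > 0")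
  case True
  have tT: "t \<in> T" using t I_T by blast
  have "convex_on UNIV (L t (xb t))"
  proof (rule convex_if_limit_of_convex[OF tT t(2)])
    fix e :: real assume "e > 0"
    with True obtain s where s: "s \<in> kappa I" "\<bar>s - t\<bar> < e" "ts_nu T s > 0" by blast
    moreover have "s \<in> T" using s kappa_subset I_T by blast
    ultimately show "\<exists>s\<in>T. \<bar>s - t\<bar> < e \<and> convex_on UNIV (L s (xb t))"
      using convex_if_nu_pos conv by blast
  qed
  then show ?thesis by (rule excess_nonneg_if_convex[OF tT])
next
  case False
  then obtain e0 where e0: "e0 > 0" "\<And>s. s \<in> kappa I \<Longrightarrow> \<bar>s - t\<bar> < e0 \<Longrightarrow> \<not> ts_nu T s > 0" by blast
  have ld0: "left_dense I s" if "s \<in> kappa I" "\<bar>s - t\<bar> < e0" for s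
    using e0(2)[OF that] left_scattered_nu_pos that kappa_subset by blast
  have tT: "t \<in> T" using t I_T by blast
  let ?r = "nabla_deriv I xb"
  have xb_cont: "continuous_on I xb" and r: "pld ?r" using f by (auto simp: C1_pld_def)
  obtain \<delta> where AB: "xb a = A" "xb b = B" and "\<delta> > 0"
    and m: "\<And>y. C1_ld I y \<Longrightarrow> y a = A \<Longrightarrow> y b = B \<Longrightarrow> (\<forall>t\<in>kappa I. \<bar>y (rh t) - xb (rh t)\<bar> \<le> \<delta>)
      \<Longrightarrow> functional L T a b xb \<le> functional L T a b y"
    using min unfolding strong_local_min_def I_eq[symmetric] by blast
  \<comment> \<open>A point of \<open>I\<close> on the chosen side, within \<open>e0\<close> of
    \<open>t\<close>, spans a full real interval with \<open>t\<close>, since all points of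
    \<open>I\<close> between them are left-dense. Cutting it down to distance \<open>d\<close>
    brings the derivative close to \<open>l\<close>.\<close>
  have near: "\<exists>u v. u < v \<and> {u..v} \<subseteq> I \<and> (\<forall>s\<in>{u<..<v}. \<bar>s - t\<bar> < e \<and> \<bar>xb s - xb t\<bar> < e \<and> \<bar>?r s - l\<bar> < e)"
    if "e > 0" for e
  proof -
    have "(xb \<longlongrightarrow> xb t) (at t within I)" using xb_cont t by (simp add: continuous_on_def)
    then have xl: "(xb \<longlongrightarrow> xb t) (at t within kappa I \<inter> X)"
      by (rule tendsto_within_subset) (use kappa_subset in auto)
    have tl: "((\<lambda>s. s) \<longlongrightarrow> t) (at t within kappa I \<inter> X)" by (rule tendsto_ident_at)
    have "\<forall>\<^sub>F s in at t within kappa I \<inter> X. \<bar>s - t\<bar> < e \<and> \<bar>xb s - xb t\<bar> < e \<and> \<bar>?r s - l\<bar> < e"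
      using tendstoD[OF tl that] tendstoD[OF xl that] tendstoD[OF l that]
      by eventually_elim (simp add: dist_real_def)
    then obtain d where d: "d > 0" "\<And>s. s \<in> kappa I \<inter> X \<Longrightarrow> s \<noteq> t \<Longrightarrow> \<bar>s - t\<bar> < d \<Longrightarrow>
        \<bar>s - t\<bar> < e \<and> \<bar>xb s - xb t\<bar> < e \<and> \<bar>?r s - l\<bar> < e"
      unfolding eventually_at dist_real_def by blast
    from side show ?thesis
    proof
      assume s: "a < t \<and> left_dense I t \<and> X = {..<t}"
      then obtain c where c: "c \<in> I" "t - e0 < c" "c < t" using left_denseD[of t "t - e0"] t e0 by auto
      have "{c..t} \<subseteq> I"
      proof (rule interval_subset_of_left_dense[OF c(1) t(1)])
        fix s assume "s \<in> I" "c < s" "s \<le> t"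
        with c ge_a[OF c(1)] show "left_dense I s" by (intro ld0 kappa_I) auto
      qed
      moreover have "s' \<in> kappa I" if "c < s'" "s' < t" for s'
        using that \<open>{c..t} \<subseteq> I\<close> ge_a[OF c(1)] by (intro kappa_I) auto
      ultimately show ?thesis
        using c d s by (intro exI[of _ "max c (t - d)"] exI[of _ t]) auto
    next
      assume s: "t < b \<and> right_dense I t \<and> X = {t<..}"
      then obtain c where c: "c \<in> I" "t < c" "c < t + e0" using right_denseD[of t "t + e0"] t e0 by auto
      have "{t..c} \<subseteq> I"
      proof (rule interval_subset_of_left_dense[OF t(1) c(1)])
        fix s assume "s \<in> I" "t < s" "s \<le> c"
        with c ge_a[OF t(1)] show "left_dense I s" by (intro ld0 kappa_I) auto
      qed
      moreover have "s' \<in> kappa I" if "t < s'" "s' < c" for s'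
        using that \<open>{t..c} \<subseteq> I\<close> ge_a[OF t(1)] by (intro kappa_I) auto
      ultimately show ?thesis
        using c d s by (intro exI[of _ t] exI[of _ "min c (t + d)"]) auto
    qed
  qed
  have two: "\<kappa> * L t (xb t) (l + (q - l)) + L t (xb t) (l - \<kappa> * (q - l)) - (1 + \<kappa>) * L t (xb t) l \<ge> 0" if "\<kappa> > 0" for \<kappa>
  proof (rule weierstrass_two_slopes[OF r xb_cont _ AB(2) functional_eq[OF xb_cont r] \<open>\<delta> > 0\<close> _ tT t(2) near that])
    show "xb u = A + integral {a..u} (\<lambda>s. ?r (up s))" if "u \<in> I" for u
      using C1_pld_eq_integral[OF f that] AB by simp
    show "functional L T a b xb \<le> functional L T a b z"
      if "C1_ld I z" "z a = A" "z b = B" "\<And>t. t \<in> I \<Longrightarrow> \<bar>z t - xb t\<bar> \<le> \<delta>" for z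
      using that rho_mem kappa_subset by (intro m) auto
  qed
  from two_slopes_imp_tangent[OF L_has_deriv[OF tT] two]
  show ?thesis by (simp add: excess_def)
qed

end

theorem theorem6p14:
  fixes T :: "real set" and a b A B :: real
    and L :: "real \<Rightarrow> real \<Rightarrow> real \<Rightarrow> real" and xb :: "real \<Rightarrow> real"
  defines "I \<equiv> ts_interval T a b"
  assumes "time_scale T" and "a \<in> T" and "b \<in> T" and "a < b"
    and "\<And>t. t \<in> T \<Longrightarrow> C2_fun (\<lambda>(x, r). L t x r)"
    and "ld_continuous_first T L"
    and "\<And>t x r1 r2 \<gamma>. t \<in> kappa I \<Longrightarrow> 0 \<le> \<gamma> \<Longrightarrow> \<gamma> \<le> 1 \<Longrightarrow>
           ts_nu T t * L t x (\<gamma> * r1 + (1 - \<gamma>) * r2)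
             \<le> ts_nu T t * \<gamma> * L t x r1 + ts_nu T t * (1 - \<gamma>) * L t x r2"
    and "C1_pld I xb"
    and "strong_local_min L T a b A B xb"
  shows "\<forall>t\<in>kappa I. \<forall>q.
           (if nabla_differentiable I xb t
            then excess L t (xb (ts_rho I t)) (nabla_deriv I xb t) q \<ge> 0
            else excess L t (xb (ts_rho I t)) (nabla_deriv_left I xb t) q \<ge> 0 \<and>
                 excess L t (xb (ts_rho I t)) (nabla_deriv_right I xb t) q \<ge> 0)"
proof -
  interpret lagrangian I a b T L
  proof
    have "I = T \<inter> {a..b}" by (auto simp: I_def ts_interval_def)
    then show "closed I" using \<open>time_scale T\<close> by (simp add: time_scale_def closed_Int)
  qed (use assms in \<open>auto simp: ts_interval_def\<close>)
  note f = \<open>C1_pld I xb\<close>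
  note E = excess_nonneg_at_one_sided_limit[OF f \<open>strong_local_min L T a b A B xb\<close> assms(8)]
  have p: "pld (nabla_deriv I xb)" using f by (simp add: C1_pld_def)
  have goal: "if nabla_differentiable I xb t
            then excess L t (xb (rh t)) (nabla_deriv I xb t) q \<ge> 0
            else excess L t (xb (rh t)) (nabla_deriv_left I xb t) q \<ge> 0 \<and>
                 excess L t (xb (rh t)) (nabla_deriv_right I xb t) q \<ge> 0" if t: "t \<in> kappa I" for t q
  proof -
    have tI: "t \<in> I" "t \<in> T" using t kappa_subset I_T by blast+
    show ?thesis
    \<comment> \<open>Positive graininess gives the inequality for every slope; this includes
      \<open>t = a\<close> when \<open>a\<close> is left-scattered in \<open>T\<close>.\<close>
    proof (cases "ts_nu T t > 0")
      case True
      have "excess L t x r q \<ge> 0" for x r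
        using excess_nonneg_if_convex[OF tI(2) convex_if_nu_pos[OF True]] assms(8)[OF t] by blast
      then show ?thesis by simp
    next
      case False
      then have ldT: "left_dense T t" using nu_pos_or_left_dense tI by blast
      have ldI: "left_dense I t" using False left_scattered_nu_pos tI by blast
      then have rt: "rh t = t" by (simp add: left_dense_def)
      have left: "excess L t (xb t) l q \<ge> 0"
        if "a < t" "(nabla_deriv I xb \<longlongrightarrow> l) (at t within kappa I \<inter> {..<t})" for l
        using E[OF _ _ _ tI(1) ldT _ that(2)] that(1) ldI by blast
      have right: "excess L t (xb t) l q \<ge> 0"
        if "t < b" "right_dense I t" "(nabla_deriv I xb \<longlongrightarrow> l) (at t within kappa I \<inter> {t<..})" for l
        using E[OF _ _ _ tI(1) ldT _ that(3)] that(1,2) by blast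
      show ?thesis
      proof (cases "nabla_differentiable I xb t")
        case True
        have "excess L t (xb t) (nabla_deriv I xb t) q \<ge> 0"
        proof (cases "a < t")
          case at: True
          obtain l where "(nabla_deriv I xb \<longlongrightarrow> l) (at t within kappa I \<inter> {..<t})"
            using pldD_left[OF p t ldI] by blast
          with left[OF at] C1_pld_nabla_deriv_eq_left[OF f tI(1) at ldI _ True] show ?thesis by metis
        next
          case False
          \<comment> \<open>At \<open>a\<close> the derivative is recovered as the right limit
            instead.\<close>
          with kappa_cases[OF t] have ta: "t = a" and rd: "right_dense I a" by auto
          obtain l where l: "(nabla_deriv I xb \<longlongrightarrow> l) (at a within kappa I \<inter> {a<..})"
            using pldD_right[OF p] t ta rd by blast
          then have "nabla_deriv I xb a = l" using nabla_deriv_eq C1_pld_differentiable_a[OF f rd] by blast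
          with right l ta rd a_less_b show ?thesis by metis
        qed
        with True rt show ?thesis by simp
      next
        case False
        note nd = C1_pld_not_differentiableD[OF f t ldI False]
        obtain l where l: "(nabla_deriv I xb \<longlongrightarrow> l) (at t within kappa I \<inter> {..<t})"
          using pldD_left[OF p t ldI] by blast
        obtain l' where l': "(nabla_deriv I xb \<longlongrightarrow> l') (at t within kappa I \<inter> {t<..})"
          using pldD_right[OF p t nd(3)] by blast
        \<comment> \<open>The filter is nontrivial at a corner, so \<open>Lim\<close> returns the
          limit.\<close>
        have "nabla_deriv_left I xb t = l"
          unfolding nabla_deriv_left_def using at_left_kappa_neq_bot[OF tI(1) nd(1) ldI] l by (rule tendsto_Lim)
        moreover have "nabla_deriv_right I xb t = l'"
          unfolding nabla_deriv_right_def using at_right_kappa_neq_bot[OF tI(1) nd(2,3)] l' by (rule tendsto_Lim)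
        ultimately show ?thesis using False rt left[OF nd(1) l] right[OF nd(2,3) l'] by simp
      qed
    qed
  qed
  then show ?thesis by blast
qed

end
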